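(* Let $M$ be a regular matroid with ground set $E$, and let $\sigma$ and $\sigma^*$ be acyclic signatures of the circuits and of the cocircuits of $M$, respectively. Given a basis $B$ of $M$, let $\mathcal{O}(B)$ be the orientation of $M$ in which each $e\notin B$ is oriented according to its orientation in $\sigma(C(B,e))$ and each $e\in B$ is oriented according to its orientation in $\sigma^*(C^*(B,e))$. Then the map $B\mapsto[\mathcal{O}(B)]$ gives a bijection $\beta:B(M)\to\mathcal{G}(M)$ from the set $B(M)$ of bases of $M$ to the set $\mathcal{G}(M)$ of circuit-cocircuit reversal classes of orientations of $M$.
   Context: $M$ is represented by a totally unimodular $r\times m$ matrix $A$ of rank $r$ (every square submatrix has determinant in $\{0,\pm1\}$), with columns indexed by $E$. A signed circuit of $M$ is a nonzero vector in $\ker(A)\cap\mathbb{Z}^E$ with all entries in $\{0,\pm1\}$ whose support is a circuit of $M$; a signed cocircuit is a nonzero vector in (row space of $A$) $\cap\,\mathbb{Z}^E$ with all entries in $\{0,\pm1\}$ whose support is a cocircuit of $M$. Each circuit (cocircuit) is the support of exactly two signed circuits (cocircuits), which are negatives of each other. A signature $\sigma$ of the circuits assigns to each circuit $\underline{C}$ a signed circuit $\sigma(\underline{C})$ with support $\underline{C}$; it is acyclic if the only nonnegative reals $a_{\underline{C}}$ with $\sum_{\underline{C}} a_{\underline{C}}\,\sigma(\underline{C})=0$ are all zero. Signatures $\sigma^*$ of the cocircuits and acyclicity are defined analogously. For a basis $B$ and $e\notin B$, $C(B,e)$ is the unique circuit contained in $B\cup\{e\}$; for $e\in B$, $C^*(B,e)$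 is the unique cocircuit contained in $(E\setminus B)\cup\{e\}$. An orientation of $M$ is a function $\mathcal{O}:E\to\{-1,1\}$; orienting $e$ according to a signed (co)circuit $C$ with $e$ in its support means setting $\mathcal{O}(e)=C(e)$. An orientation $\mathcal{O}$ is compatible with a signed circuit or cocircuit $C$ if $\mathcal{O}(e)=C(e)$ for all $e$ in the support of $C$; in that case the reversal along $C$ negates $\mathcal{O}$ on the support of $C$ and leaves it unchanged elsewhere. $\mathcal{G}(M)$ is the set of classes of orientations under the equivalence relation generated by all circuit and cocircuit reversals, and $[\mathcal{O}]$ is the class of $\mathcal{O}$. *)

theory Defs
  imports
    Main
    "HOL-Library.FuncSet"
    "Jordan_Normal_Form.DL_Submatrix"
    "Jordan_Normal_Form.DL_Rank"
    "Jordan_Normal_Form.Matrix_Kernel"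
begin

section \<open>Matroids\<close>

locale matroid =
  fixes E :: "'e set" and indep :: "'e set \<Rightarrow> bool"
  assumes finite_ground: "finite E"
    and indep_subset_ground: "indep X \<Longrightarrow> X \<subseteq> E"
    and indep_empty: "indep {}"
    and indep_subset: "indep X \<Longrightarrow> Y \<subseteq> X \<Longrightarrow> indep Y"
    and indep_augment: "indep X \<Longrightarrow> indep Y \<Longrightarrow> card X < card Y \<Longrightarrow> \<exists>e\<in>Y - X. indep (insert e X)"

definition bases :: "('e set \<Rightarrow> bool) \<Rightarrow> 'e set set" where
  "bases indep = {B. indep B \<and> (\<forall>X. indep X \<and> B \<subseteq> X \<longrightarrow> X = B)}"

definition circuits :: "'e set \<Rightarrow> ('e set \<Rightarrow> bool) \<Rightarrow> 'e set set" where
  "circuits E indep = {C. C \<subseteq> E \<and> \<not> indep C \<and> (\<forall>D. D \<subset> C \<longrightarrow> indep D)}"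

definition dual_indep :: "'e set \<Rightarrow> ('e set \<Rightarrow> bool) \<Rightarrow> 'e set \<Rightarrow> bool" where
  "dual_indep E indep X \<longleftrightarrow> (\<exists>B\<in>bases indep. X \<subseteq> E - B)"

definition cocircuits :: "'e set \<Rightarrow> ('e set \<Rightarrow> bool) \<Rightarrow> 'e set set" where
  "cocircuits E indep = circuits E (dual_indep E indep)"

text \<open>The fundamental circuit of \<open>e\<close> is only meaningful for \<open>e \<in> E - B\<close>, and the
  fundamental cocircuit only for \<open>e \<in> B\<close>, where \<open>B\<close> is a basis.\<close>

definition fund_circuit :: "'e set \<Rightarrow> ('e set \<Rightarrow> bool) \<Rightarrow> 'e set \<Rightarrow> 'e \<Rightarrow> 'e set" where
  "fund_circuit E indep B e = (THE C. C \<in> circuits E indep \<and> C \<subseteq> insert e B)"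

definition fund_cocircuit :: "'e set \<Rightarrow> ('e set \<Rightarrow> bool) \<Rightarrow> 'e set \<Rightarrow> 'e \<Rightarrow> 'e set" where
  "fund_cocircuit E indep B e = (THE C. C \<in> cocircuits E indep \<and> C \<subseteq> insert e (E - B))"

section \<open>Regular matroids\<close>

definition totally_unimodular :: "real mat \<Rightarrow> bool" where
  "totally_unimodular A \<longleftrightarrow>
     (\<forall>I J. I \<subseteq> {0..<dim_row A} \<and> J \<subseteq> {0..<dim_col A} \<and> card I = card J
        \<longrightarrow> det (submatrix A I J) \<in> {-1, 0, 1})"

text \<open>The bijection \<open>ix\<close> labels the columns of \<open>A\<close> by \<open>E\<close>: the column of \<open>e\<close> is
  \<open>col A (ix e)\<close>. Injectivity on \<open>X\<close> makes parallel elements dependent.\<close>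

definition represents :: "nat \<Rightarrow> real mat \<Rightarrow> ('e \<Rightarrow> nat) \<Rightarrow> 'e set \<Rightarrow> ('e set \<Rightarrow> bool) \<Rightarrow> bool" where
  "represents r A ix E indep \<longleftrightarrow>
     A \<in> carrier_mat r (card E) \<and> bij_betw ix E {0..<card E} \<and>
     (\<forall>X. indep X \<longleftrightarrow> X \<subseteq> E \<and> inj_on (\<lambda>e. col A (ix e)) X \<and>
        \<not> LinearCombinations.module.lin_dep class_ring (module_vec TYPE(real) r)
            ((\<lambda>e. col A (ix e)) ` X))"

section \<open>Signed circuits and cocircuits\<close>

text \<open>Elements of \<open>\<int>\<^sup>E\<close> are functions \<open>'e \<Rightarrow> int\<close> that vanish outside \<open>E\<close>.\<close>

definition signed_support :: "('e \<Rightarrow> int) \<Rightarrow> 'e set" where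
  "signed_support x = {e. x e \<noteq> 0}"

definition sign_vectors :: "'e set \<Rightarrow> ('e \<Rightarrow> int) set" where
  "sign_vectors E = {x. (\<forall>e\<in>E. x e \<in> {-1, 0, 1}) \<and> (\<forall>e. e \<notin> E \<longrightarrow> x e = 0)}"

definition to_vec :: "('e \<Rightarrow> nat) \<Rightarrow> 'e set \<Rightarrow> ('e \<Rightarrow> int) \<Rightarrow> real vec" where
  "to_vec ix E x = vec (card E) (\<lambda>j. of_int (x (inv_into E ix j)))"

definition signed_circuits ::
  "real mat \<Rightarrow> ('e \<Rightarrow> nat) \<Rightarrow> 'e set \<Rightarrow> ('e set \<Rightarrow> bool) \<Rightarrow> ('e \<Rightarrow> int) set" where
  "signed_circuits A ix E indep =
     {x \<in> sign_vectors E. x \<noteq> (\<lambda>_. 0) \<and> to_vec ix E x \<in> mat_kernel A \<and>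
        signed_support x \<in> circuits E indep}"

definition signed_cocircuits ::
  "real mat \<Rightarrow> ('e \<Rightarrow> nat) \<Rightarrow> 'e set \<Rightarrow> ('e set \<Rightarrow> bool) \<Rightarrow> ('e \<Rightarrow> int) set" where
  "signed_cocircuits A ix E indep =
     {x \<in> sign_vectors E. x \<noteq> (\<lambda>_. 0) \<and> to_vec ix E x \<in> vec_space.row_space (card E) A \<and>
        signed_support x \<in> cocircuits E indep}"

section \<open>Signatures\<close>

text \<open>Here \<open>\<C>\<close> is the set of circuits (cocircuits) and \<open>S\<close> the set of signed circuits
  (signed cocircuits). Values of \<open>\<sigma>\<close> outside \<open>\<C>\<close> are irrelevant.\<close>

definition signature :: "'e set set \<Rightarrow> ('e \<Rightarrow> int) set \<Rightarrow> ('e set \<Rightarrow> 'e \<Rightarrow> int) \<Rightarrow> bool" where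
  "signature \<C> S \<sigma> \<longleftrightarrow> (\<forall>C\<in>\<C>. \<sigma> C \<in> S \<and> signed_support (\<sigma> C) = C)"

definition acyclic_signature :: "'e set \<Rightarrow> 'e set set \<Rightarrow> ('e set \<Rightarrow> 'e \<Rightarrow> int) \<Rightarrow> bool" where
  "acyclic_signature E \<C> \<sigma> \<longleftrightarrow>
     (\<forall>a :: 'e set \<Rightarrow> real.
        (\<forall>C\<in>\<C>. 0 \<le> a C) \<and> (\<forall>e\<in>E. (\<Sum>C\<in>\<C>. a C * of_int (\<sigma> C e)) = 0)
        \<longrightarrow> (\<forall>C\<in>\<C>. a C = 0))"

section \<open>Orientations and reversal classes\<close>

text \<open>Orientations are extensional, so that two orientations are equal iff they agree on \<open>E\<close>.\<close>

definition orientations :: "'e set \<Rightarrow> ('e \<Rightarrow> int) set" where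
  "orientations E = E \<rightarrow>\<^sub>E {-1, 1}"

definition compatible :: "('e \<Rightarrow> int) \<Rightarrow> ('e \<Rightarrow> int) \<Rightarrow> bool" where
  "compatible \<O> C \<longleftrightarrow> (\<forall>e\<in>signed_support C. \<O> e = C e)"

definition reversal :: "('e \<Rightarrow> int) \<Rightarrow> ('e \<Rightarrow> int) \<Rightarrow> ('e \<Rightarrow> int)" where
  "reversal C \<O> = (\<lambda>e. if e \<in> signed_support C then - \<O> e else \<O> e)"

definition reversal_step ::
  "real mat \<Rightarrow> ('e \<Rightarrow> nat) \<Rightarrow> 'e set \<Rightarrow> ('e set \<Rightarrow> bool) \<Rightarrow> (('e \<Rightarrow> int) \<times> ('e \<Rightarrow> int)) set" where
  "reversal_step A ix E indep =
     {(\<O>, reversal C \<O>) | \<O> C. \<O> \<in> orientations E \<and>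
        C \<in> signed_circuits A ix E indep \<union> signed_cocircuits A ix E indep \<and> compatible \<O> C}"

definition reversal_equiv ::
  "real mat \<Rightarrow> ('e \<Rightarrow> nat) \<Rightarrow> 'e set \<Rightarrow> ('e set \<Rightarrow> bool) \<Rightarrow> (('e \<Rightarrow> int) \<times> ('e \<Rightarrow> int)) set" where
  "reversal_equiv A ix E indep =
     (reversal_step A ix E indep \<union> (reversal_step A ix E indep)\<inverse>)\<^sup>*
       \<inter> orientations E \<times> orientations E"

definition reversal_class ::
  "real mat \<Rightarrow> ('e \<Rightarrow> nat) \<Rightarrow> 'e set \<Rightarrow> ('e set \<Rightarrow> bool) \<Rightarrow> ('e \<Rightarrow> int) \<Rightarrow> ('e \<Rightarrow> int) set" where
  "reversal_class A ix E indep \<O> = reversal_equiv A ix E indep `` {\<O>}"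

definition reversal_classes ::
  "real mat \<Rightarrow> ('e \<Rightarrow> nat) \<Rightarrow> 'e set \<Rightarrow> ('e set \<Rightarrow> bool) \<Rightarrow> ('e \<Rightarrow> int) set set" where
  "reversal_classes A ix E indep = orientations E // reversal_equiv A ix E indep"

definition basis_orientation ::
  "'e set \<Rightarrow> ('e set \<Rightarrow> bool) \<Rightarrow> ('e set \<Rightarrow> 'e \<Rightarrow> int) \<Rightarrow> ('e set \<Rightarrow> 'e \<Rightarrow> int) \<Rightarrow> 'e set \<Rightarrow> 'e \<Rightarrow> int" where
  "basis_orientation E indep \<sigma> \<sigma>' B =
     (\<lambda>e\<in>E. if e \<in> B then \<sigma>' (fund_cocircuit E indep B e) e else \<sigma> (fund_circuit E indep B e) e)"

end

theory Submission
  imports Defs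
begin

text \<open>
  The bijection is linear programming duality in disguise. Call an orientation
  \<^emph>\<open>compatible\<close> (\<open>compat\<close>) if no reversed signed circuit \<open>-\<sigma>(C)\<close> and no reversed signed
  cocircuit \<open>-\<sigma>'(D)\<close> agrees with it. The compatible orientations form a common set of
  representatives: they are exactly the orientations that come from bases, each from a single
  basis, and every reversal class contains exactly one of them.

  By Gordan's theorem (\<open>gordan\<close>), acyclicity of \<open>\<sigma>\<close> and \<open>\<sigma>'\<close> yields weights \<open>w\<close> and \<open>w'\<close> on \<open>E\<close>
  with \<open>\<langle>w, \<sigma>(C)\<rangle> > 0\<close> for all circuits and \<open>\<langle>w', \<sigma>'(D)\<rangle> > 0\<close> for all cocircuits. Let \<open>V\<close> be the
  space of flows (orthogonal to all signed cocircuits) and \<open>W\<close> the space of tensions (orthogonal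
  to all signed circuits). For an orientation \<open>s\<close> consider the linear program: minimise
  \<open>\<langle>w, x\<rangle>\<close> over the \<open>x \<in> w' + V\<close> whose signs agree with \<open>s\<close>.

  \<^item> For a basis \<open>B\<close>, the signs prescribed on \<open>B\<close> by the fundamental cocircuits say that
    the basic solution \<open>x\<close> of \<open>B\<close> is feasible, and those prescribed off \<open>B\<close> by the fundamental
    circuits say that the reduced costs \<open>y\<close> of \<open>B\<close> are dual feasible. So the orientation of \<open>B\<close>
    is \<open>s\<close> iff \<open>B\<close> is an optimal basis of the program of \<open>s\<close>. The pair \<open>(x, y)\<close> is a certificate
    of compatibility (\<open>induces_compat\<close>), and strict feasibility on both sides makes \<open>B\<close> unique
    (\<open>induces_unique\<close>).
  \<^item> If \<open>s\<close> is compatible, then the program and its dual are feasible, because conformal vectors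
    decompose into conformal circuits (\<open>compat_weight_nonneg\<close>). Strong duality
    (\<open>strong_duality\<close>) gives complementary optimal solutions. Their supports contain
    no circuit and no cocircuit since \<open>w\<close> and \<open>w'\<close> are nonzero on these, hence they are separated
    by a basis, and this basis induces \<open>s\<close> (\<open>compat_induced_by_basis\<close>).
  \<^item> By Minty's lemma, every element lies either in a directed circuit or in a directed cocircuit of
    an orientation, and reversals preserve this partition. Hence the difference of two equivalent
    orientations splits into a flow on the cyclic part and a tension on the acyclic part; a
    nonzero flow would contain a circuit directed one way in the first orientation and the
    other way in the second, which cannot happen if both are compatible (\<open>linked_compat_eq\<close>).
  \<^item> Every class contains a compatible orientation: one that maximises the sum of \<open>w(e) s(e)\<close> over the
    cyclic part plus \<open>w'(e) s(e)\<close> over the acyclic part (\<open>ex_compat_in_class\<close>).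

  Of the matrix, the argument uses that its kernel is orthogonal to its row space. Circuits and
  cocircuits enter symmetrically, so the work is done in a locale that is its own dual.
\<close>

section \<open>Minty's lemma and Gordan's theorem\<close>

definition dot :: "'i set \<Rightarrow> ('i \<Rightarrow> real) \<Rightarrow> ('i \<Rightarrow> real) \<Rightarrow> real" where
  "dot I x y = (\<Sum>i\<in>I. x i * y i)"

lemma dot_commute: "dot I x y = dot I y x"
  by (simp add: dot_def mult.commute)

lemma dot_linear:
  "dot I (\<lambda>i. x i + y i) z = dot I x z + dot I y z"
  "dot I (\<lambda>i. x i - y i) z = dot I x z - dot I y z"
  "dot I (\<lambda>i. a * x i) z = a * dot I x z"
  "dot I (\<lambda>i. x i / a) z = dot I x z / a"
  "dot I (\<lambda>i. - x i) z = - dot I x z"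
  "dot I z (\<lambda>i. x i + y i) = dot I z x + dot I z y"
  "dot I z (\<lambda>i. x i - y i) = dot I z x - dot I z y"
  "dot I z (\<lambda>i. a * x i) = a * dot I z x"
  "dot I z (\<lambda>i. x i / a) = dot I z x / a"
  "dot I z (\<lambda>i. - x i) = - dot I z x"
  by (simp_all add: dot_def algebra_simps sum.distrib sum_subtractf sum_distrib_left
      sum_divide_distrib sum_negf)

lemma dot_zero [simp]: "dot I (\<lambda>i. 0) z = 0" "dot I z (\<lambda>i. 0) = 0"
  by (simp_all add: dot_def)

lemma dot_sum_left: "dot I (\<lambda>i. \<Sum>k\<in>K. x k i) z = (\<Sum>k\<in>K. dot I (x k) z)"
  by (simp add: dot_def sum_distrib_right sum.swap[of _ I K])

lemma dot_cong: "(\<And>i. i \<in> I \<Longrightarrow> x i = x' i) \<Longrightarrow> dot I x z = dot I x' z"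
  by (simp add: dot_def)

lemma dot_single:
  assumes "finite I" "k \<in> I" "\<And>i. i \<in> I \<Longrightarrow> i \<noteq> k \<Longrightarrow> x i * y i = 0"
  shows "dot I x y = x k * y k"
proof -
  have "dot I x y = (\<Sum>i\<in>{k}. x i * y i)"
    unfolding dot_def using assms by (intro sum.mono_neutral_right) auto
  then show ?thesis by simp
qed

definition lincomb_closed :: "('i \<Rightarrow> real) set \<Rightarrow> bool" where
  "lincomb_closed U \<longleftrightarrow> (\<forall>u\<in>U. \<forall>v\<in>U. \<forall>a b. (\<lambda>i. a * u i + b * v i) \<in> U)"

text \<open>Minty's lemma for a linear space \<open>U\<close> by induction on the coordinates. Let \<open>f\<close> be a new
  coordinate. Forgetting \<open>f\<close> in \<open>U\<close> corresponds to \<open>z f = 0\<close> in the orthogonal space, and imposing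
  \<open>u f = 0\<close> corresponds to forgetting \<open>f\<close> there. If the induction hypothesis gives none of the two vectors
  directly, it gives \<open>u \<in> U\<close> and an orthogonal \<open>z\<close>, both good away from \<open>f\<close>; then
  \<open>u f * z f\<close> is negative by orthogonality, so one of the two is good at \<open>f\<close> as well.\<close>
lemma minty_insert:
  assumes "finite J" "k \<notin> J" "lincomb_closed U"
  shows "(\<exists>u\<in>U. (\<forall>i\<in>insert k J. 0 \<le> u i) \<and> 0 < u k) \<or>
    (\<exists>z. (\<forall>u\<in>U. dot (insert k J) u z = 0) \<and> (\<forall>i\<in>insert k J. 0 \<le> z i) \<and> 0 < z k)"
  using assms
proof (induction J arbitrary: U rule: finite_induct)
  case empty
  show ?case
  proof (cases "\<exists>u\<in>U. u k \<noteq> 0")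
    case True
    then obtain u where u: "u \<in> U" "u k \<noteq> 0" by blast
    then have "(\<lambda>i. (1 / u k) * u i + 0 * u i) \<in> U"
      using empty.prems unfolding lincomb_closed_def by blast
    then show ?thesis using u by (intro disjI1 bexI) auto
  next
    case False
    then show ?thesis by (intro disjI2 exI[of _ "\<lambda>_. 1"]) (auto simp: dot_def)
  qed
next
  case (insert f J)
  let ?I = "insert k J"
  have f: "f \<notin> ?I" "finite ?I" and sub: "insert k (insert f J) = insert f ?I"
    using insert.hyps insert.prems by auto
  have dotf: "dot (insert f ?I) u z = u f * z f + dot ?I u z" for u z
    using f by (simp add: dot_def)
  let ?goal = "(\<exists>u\<in>U. (\<forall>i\<in>insert f ?I. 0 \<le> u i) \<and> 0 < u k) \<or>
    (\<exists>z. (\<forall>u\<in>U. dot (insert f ?I) u z = 0) \<and> (\<forall>i\<in>insert f ?I. 0 \<le> z i) \<and> 0 < z k)"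
  have ?goal
  proof (cases "\<exists>u\<in>U. (\<forall>i\<in>?I. 0 \<le> u i) \<and> 0 < u k")
    case False
    then obtain z where z: "\<forall>u\<in>U. dot ?I u z = 0" "\<forall>i\<in>?I. 0 \<le> z i" "0 < z k"
      using insert.IH[of U] insert.prems by auto
    have "dot ?I u (z(f := 0)) = dot ?I u z" for u
      unfolding dot_def using f by (intro sum.cong) auto
    then show ?thesis
      using z f by (intro disjI2 exI[of _ "z(f := 0)"]) (auto simp: dotf)
  next
    case True
    then obtain u where u: "u \<in> U" "\<forall>i\<in>?I. 0 \<le> u i" "0 < u k" by blast
    let ?U = "{u\<in>U. u f = 0}"
    have "lincomb_closed ?U"
      using insert.prems(2) by (auto simp: lincomb_closed_def)
    then consider (primal) v where "v \<in> ?U" "\<forall>i\<in>?I. 0 \<le> v i" "0 < v k"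
      | (dual) z where "\<forall>v\<in>?U. dot ?I v z = 0" "\<forall>i\<in>?I. 0 \<le> z i" "0 < z k"
      using insert.IH[of ?U] insert.prems by auto
    then show ?thesis
    proof cases
      case primal
      then show ?thesis by (intro disjI1 bexI[of _ v]) auto
    next
      case dual
      \<comment> \<open>Lift \<open>z\<close> from the hyperplane \<open>v f = 0\<close> to all of \<open>U\<close> by a suitable value \<open>s\<close> at \<open>f\<close>.\<close>
      obtain s where s: "\<And>v. v \<in> U \<Longrightarrow> v f * s + dot ?I v z = 0"
      proof (cases "\<exists>v\<in>U. v f \<noteq> 0")
        case True
        then obtain v0 where v0: "v0 \<in> U" "v0 f \<noteq> 0" by blast
        show ?thesis
        proof (rule that[of "- dot ?I v0 z / v0 f"])
          fix v assume "v \<in> U"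
          then have "(\<lambda>i. 1 * v i + (- (v f / v0 f)) * v0 i) \<in> U"
            using insert.prems(2) v0(1) unfolding lincomb_closed_def by blast
          then have "dot ?I (\<lambda>i. 1 * v i + (- (v f / v0 f)) * v0 i) z = 0"
            using dual(1) v0(2) by auto
          then have "dot ?I v z = (v f / v0 f) * dot ?I v0 z"
            by (simp only: dot_linear)
          then show "v f * (- dot ?I v0 z / v0 f) + dot ?I v z = 0"
            by simp
        qed
      next
        case False
        then show ?thesis using dual(1) by (intro that[of 0]) auto
      qed
      let ?z = "z(f := s)"
      have eq: "dot ?I v ?z = dot ?I v z" for v
        unfolding dot_def using f by (intro sum.cong) auto
      have orth: "\<forall>v\<in>U. dot (insert f ?I) v ?z = 0"
        using s by (simp add: dotf eq del: fun_upd_apply) simp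
      have "0 < u k * z k" using u dual by simp
      also have "\<dots> \<le> dot ?I u z"
        unfolding dot_def using u dual f by (intro member_le_sum) auto
      finally have neg: "u f * s < 0" using s[OF u(1)] by linarith
      show ?thesis
      proof (cases "0 \<le> s")
        case True
        then show ?thesis using orth dual f by (intro disjI2 exI[of _ ?z]) auto
      next
        case False
        then have "0 \<le> u f" using neg by (simp add: mult_less_0_iff)
        then show ?thesis using u by (intro disjI1 bexI[of _ u]) auto
      qed
    qed
  qed
  then show ?case unfolding sub .
qed

lemma minty:
  assumes "finite I" "k \<in> I" "lincomb_closed U"
  obtains (primal) u where "u \<in> U" "\<And>i. i \<in> I \<Longrightarrow> 0 \<le> u i" "0 < u k"
  | (dual) z where "\<And>u. u \<in> U \<Longrightarrow> dot I u z = 0" "\<And>i. i \<in> I \<Longrightarrow> 0 \<le> z i" "0 < z k"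
  using minty_insert[of "I - {k}" k U] assms by (auto simp: insert_absorb)

text \<open>Minty's lemma for the space of all vectors \<open>(\<langle>w, c C\<rangle>)\<^sub>C\<close>: an orthogonal vector is a linear
  dependency among the \<open>c C\<close>, so acyclicity leaves only the primal alternative, for each \<open>C\<close>. The
  resulting weights are added up.\<close>
lemma gordan:
  fixes c :: "'k \<Rightarrow> 'e \<Rightarrow> real"
  assumes fin: "finite E" "finite K"
    and acyclic: "\<And>a. (\<And>C. C \<in> K \<Longrightarrow> 0 \<le> a C) \<Longrightarrow>
      (\<And>e. e \<in> E \<Longrightarrow> (\<Sum>C\<in>K. a C * c C e) = 0) \<Longrightarrow> \<forall>C\<in>K. a C = 0"
  obtains w where "\<And>C. C \<in> K \<Longrightarrow> 0 < dot E w (c C)"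
proof -
  have "\<exists>w. (\<forall>C\<in>K. 0 \<le> dot E w (c C)) \<and> 0 < dot E w (c C0)" if C0: "C0 \<in> K" for C0
  proof -
    let ?U = "range (\<lambda>w C. dot E w (c C))"
    have "lincomb_closed ?U"
      unfolding lincomb_closed_def
    proof safe
      fix w w' :: "'e \<Rightarrow> real" and a b
      show "(\<lambda>C. a * dot E w (c C) + b * dot E w' (c C)) \<in> ?U"
        by (intro image_eqI[of _ _ "\<lambda>e. a * w e + b * w' e"]) (simp_all add: dot_linear)
    qed
    with fin(2) C0 show ?thesis
    proof (cases rule: minty[of K C0 ?U])
      case (primal u)
      then show ?thesis by auto
    next
      case (dual a)
      have "(\<Sum>C\<in>K. a C * c C e) = 0" if e: "e \<in> E" for e
      proof -
        have "dot E (\<lambda>f. if f = e then 1 else 0) (c C) = c C e" for C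
          using dot_single[of E e "\<lambda>f. if f = e then 1 else 0" "c C"] fin e by simp
        then have "dot K (\<lambda>C. c C e) a = 0"
          using dual(1)[OF rangeI[of "\<lambda>w C. dot E w (c C)" "\<lambda>f. if f = e then 1 else 0"]] by simp
        then show ?thesis by (simp add: dot_def mult.commute)
      qed
      then have "a C0 = 0" using acyclic[of a] dual(2) C0 by blast
      then show ?thesis using dual(3) by simp
    qed
  qed
  then obtain W where W: "\<And>C0 C. C0 \<in> K \<Longrightarrow> C \<in> K \<Longrightarrow> 0 \<le> dot E (W C0) (c C)"
    "\<And>C0. C0 \<in> K \<Longrightarrow> 0 < dot E (W C0) (c C0)"
    by metis
  show ?thesis
  proof (rule that[of "\<lambda>e. \<Sum>C0\<in>K. W C0 e"])
    fix C assume "C \<in> K"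
    then show "0 < dot E (\<lambda>e. \<Sum>C0\<in>K. W C0 e) (c C)"
      unfolding dot_sum_left using W fin(2) by (intro sum_pos2[of K C]) auto
  qed
qed

section \<open>Conformal vectors\<close>
definition ann :: "'e set \<Rightarrow> 'k set \<Rightarrow> ('k \<Rightarrow> 'e \<Rightarrow> real) \<Rightarrow> ('e \<Rightarrow> real) set" where
  "ann E K g = {v. \<forall>k\<in>K. dot E v (g k) = 0}"

lemma annD: "v \<in> ann E K g \<Longrightarrow> k \<in> K \<Longrightarrow> dot E v (g k) = 0"
  by (simp add: ann_def)

lemma ann_linear:
  "u \<in> ann E K g \<Longrightarrow> v \<in> ann E K g \<Longrightarrow> (\<lambda>e. u e + v e) \<in> ann E K g"
  "u \<in> ann E K g \<Longrightarrow> v \<in> ann E K g \<Longrightarrow> (\<lambda>e. u e - v e) \<in> ann E K g"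
  "u \<in> ann E K g \<Longrightarrow> (\<lambda>e. a * u e) \<in> ann E K g"
  "u \<in> ann E K g \<Longrightarrow> (\<lambda>e. u e / a) \<in> ann E K g"
  "u \<in> ann E K g \<Longrightarrow> (\<lambda>e. - u e) \<in> ann E K g"
  "(\<lambda>e. 0) \<in> ann E K g"
  by (simp_all add: ann_def dot_linear)

lemma ann_sum:
  "(\<And>j. j \<in> J \<Longrightarrow> u j \<in> ann E K g) \<Longrightarrow> (\<lambda>e. \<Sum>j\<in>J. u j e) \<in> ann E K g"
  by (simp add: ann_def dot_sum_left)

text \<open>The signs of \<open>v\<close> agree with those of \<open>s\<close> wherever \<open>v\<close> is nonzero; \<open>s\<close> is an orientation in the
  applications, and only the signs of its values matter.\<close>
definition conformal :: "'e set \<Rightarrow> ('e \<Rightarrow> real) \<Rightarrow> ('e \<Rightarrow> real) \<Rightarrow> bool" where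
  "conformal E s v \<longleftrightarrow> (\<forall>e\<in>E. 0 \<le> s e * v e)"

lemma conformal_prod_nonneg:
  assumes "conformal E s x" "conformal E s y" "e \<in> E" "s e \<noteq> 0"
  shows "0 \<le> x e * y e"
proof -
  have "0 \<le> (s e * x e) * (s e * y e)"
    using assms by (simp add: conformal_def)
  then have "0 \<le> (s e * s e) * (x e * y e)" by (simp add: mult_ac)
  moreover have "0 < s e * s e" using assms(4) by (auto simp: zero_less_mult_iff)
  ultimately show ?thesis by (meson mult_pos_neg not_less)
qed

lemma conformal_dot_nonneg:
  assumes "conformal E s x" "conformal E s y" "\<And>e. e \<in> E \<Longrightarrow> s e \<noteq> 0"
  shows "0 \<le> dot E x y"
  unfolding dot_def using assms by (intro sum_nonneg conformal_prod_nonneg)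

lemma conformal_dot_nonpos_disjoint:
  assumes "finite E" "conformal E s x" "conformal E s y" "\<And>e. e \<in> E \<Longrightarrow> s e \<noteq> 0"
    and "dot E x y \<le> 0" "e \<in> E"
  shows "x e * y e = 0"
proof -
  have nn: "0 \<le> x f * y f" if "f \<in> E" for f
    using conformal_prod_nonneg[of E s x y f] assms that by blast
  then have "(\<Sum>f\<in>E. x f * y f) = 0"
    using assms(5) sum_nonneg[of E "\<lambda>f. x f * y f"] by (simp add: dot_def)
  then show ?thesis using nn assms by (simp add: sum_nonneg_eq_0_iff)
qed

text \<open>The ratio test of the simplex method: move from \<open>u\<close> against the direction \<open>z\<close> until the first
  coordinate vanishes. No sign is violated on the way, and the support shrinks.\<close>
lemma conformal_pivot:
  assumes fin: "finite E" and u: "conformal E s u"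
    and z: "\<And>e. e \<in> E \<Longrightarrow> z e \<noteq> 0 \<Longrightarrow> u e \<noteq> 0"
    and pos: "p \<in> E" "0 < s p * z p"
    and s: "\<And>e. e \<in> E \<Longrightarrow> s e \<noteq> 0"
  obtains a where "0 < a" "conformal E s (\<lambda>e. u e - a * z e)"
    "{e\<in>E. u e - a * z e \<noteq> 0} \<subset> {e\<in>E. u e \<noteq> 0}"
proof -
  let ?P = "{e\<in>E. 0 < s e * z e}"
  let ?q = "\<lambda>e. (s e * u e) / (s e * z e)"
  have P: "finite ?P" "?P \<noteq> {}" using fin pos by auto
  define a where "a = Min (?q ` ?P)"
  have "a \<in> ?q ` ?P" unfolding a_def using P by (intro Min_in) auto
  then obtain m where m: "m \<in> ?P" "a = ?q m" by blast
  have le: "a \<le> ?q e" if "e \<in> ?P" for e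
    unfolding a_def using P that by (intro Min_le) auto
  have upos: "0 < s e * u e" if "e \<in> ?P" for e
  proof -
    have "z e \<noteq> 0" using that by (cases "z e = 0") auto
    then have "s e * u e \<noteq> 0" using z[of e] s[of e] that by auto
    moreover have "0 \<le> s e * u e" using u that by (simp add: conformal_def)
    ultimately show ?thesis by (metis order_le_less)
  qed
  have a0: "0 < a" using m(1) upos[OF m(1)] unfolding m(2) by (intro divide_pos_pos) auto
  show ?thesis
  proof
    show "0 < a" by (fact a0)
    show "conformal E s (\<lambda>e. u e - a * z e)"
      unfolding conformal_def
    proof
      fix e assume e: "e \<in> E"
      show "0 \<le> s e * (u e - a * z e)"
      proof (cases "0 < s e * z e")
        case True
        then have "a * (s e * z e) \<le> s e * u e"
          using le[of e] e pos_le_divide_eq[OF True] by blast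
        then show ?thesis by (simp add: algebra_simps)
      next
        case False
        then have "a * (s e * z e) \<le> 0" using a0 mult_nonneg_nonpos[of a "s e * z e"] by linarith
        moreover have "0 \<le> s e * u e" using u e by (simp add: conformal_def)
        ultimately show ?thesis by (simp add: algebra_simps)
      qed
    qed
    have "u m - a * z m = 0" using m s[of m] by auto
    moreover have "u m \<noteq> 0" using upos[of m] m by auto
    moreover have "u e \<noteq> 0" if "e \<in> E" "u e - a * z e \<noteq> 0" for e
      using z[of e] that by auto
    ultimately show "{e\<in>E. u e - a * z e \<noteq> 0} \<subset> {e\<in>E. u e \<noteq> 0}"
      using m(1) by blast
  qed
qed

text \<open>For an orientation \<open>s\<close> and \<open>V\<close> the flows (tensions), this is the union of the directed circuits
  (cocircuits) of \<open>s\<close>.\<close>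
definition conformal_part :: "'e set \<Rightarrow> ('e \<Rightarrow> real) set \<Rightarrow> ('e \<Rightarrow> real) \<Rightarrow> 'e set" where
  "conformal_part E V s = {e\<in>E. \<exists>v\<in>V. conformal E s v \<and> v e \<noteq> 0}"

section \<open>Flows and tensions of a pair of signatures\<close>

text \<open>The data of the theorem with the matrix forgotten: what remains are circuit vectors \<open>c C\<close>
  orthogonal to cocircuit vectors \<open>d D\<close>, and the weights that witness acyclicity. The assumptions
  on bases are chosen such that exchanging circuits with cocircuits and bases with their complements
  gives another instance, which halves the work.\<close>
locale oriented_pair =
  fixes E :: "'e set" and Bs Cs Ds :: "'e set set"
    and c d :: "'e set \<Rightarrow> 'e \<Rightarrow> real" and w w' :: "'e \<Rightarrow> real"
  assumes finite_E: "finite E"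
    and basis_sub: "B \<in> Bs \<Longrightarrow> B \<subseteq> E"
    and basis_antichain: "B1 \<in> Bs \<Longrightarrow> B2 \<in> Bs \<Longrightarrow> B1 \<subseteq> B2 \<Longrightarrow> B1 = B2"
    and basis_between: "B1 \<in> Bs \<Longrightarrow> B2 \<in> Bs \<Longrightarrow> X \<subseteq> B1 \<Longrightarrow> Y \<subseteq> E - B2 \<Longrightarrow> X \<inter> Y = {} \<Longrightarrow>
      \<exists>B\<in>Bs. X \<subseteq> B \<and> Y \<subseteq> E - B"
    and circuit_sub: "C \<in> Cs \<Longrightarrow> C \<subseteq> E"
    and cocircuit_sub: "D \<in> Ds \<Longrightarrow> D \<subseteq> E"
    and basis_or_circuit: "X \<subseteq> E \<Longrightarrow> (\<exists>B\<in>Bs. X \<subseteq> B) \<or> (\<exists>C\<in>Cs. C \<subseteq> X)"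
    and cobasis_or_cocircuit: "Y \<subseteq> E \<Longrightarrow> (\<exists>B\<in>Bs. Y \<subseteq> E - B) \<or> (\<exists>D\<in>Ds. D \<subseteq> Y)"
    and ex_fund_circuit: "B \<in> Bs \<Longrightarrow> e \<in> E - B \<Longrightarrow> \<exists>C\<in>Cs. e \<in> C \<and> C \<subseteq> insert e B"
    and ex_fund_cocircuit: "B \<in> Bs \<Longrightarrow> e \<in> B \<Longrightarrow> \<exists>D\<in>Ds. e \<in> D \<and> D \<subseteq> insert e (E - B)"
    and circuit_supp: "C \<in> Cs \<Longrightarrow> c C e \<noteq> 0 \<longleftrightarrow> e \<in> C"
    and cocircuit_supp: "D \<in> Ds \<Longrightarrow> d D e \<noteq> 0 \<longleftrightarrow> e \<in> D"
    and circuit_cocircuit_orth: "C \<in> Cs \<Longrightarrow> D \<in> Ds \<Longrightarrow> dot E (c C) (d D) = 0"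
    and circuit_weight: "C \<in> Cs \<Longrightarrow> 0 < dot E w (c C)"
    and cocircuit_weight: "D \<in> Ds \<Longrightarrow> 0 < dot E w' (d D)"
begin

lemma dual_pair: "oriented_pair E ((-) E ` Bs) Ds Cs d c w' w"
proof
  show "finite E" by (fact finite_E)
  show "B \<subseteq> E" if "B \<in> (-) E ` Bs" for B using that by auto
  show "B1 = B2" if "B1 \<in> (-) E ` Bs" "B2 \<in> (-) E ` Bs" "B1 \<subseteq> B2" for B1 B2
  proof -
    obtain A1 A2 where A: "A1 \<in> Bs" "A2 \<in> Bs" "B1 = E - A1" "B2 = E - A2"
      using \<open>B1 \<in> (-) E ` Bs\<close> \<open>B2 \<in> (-) E ` Bs\<close> by auto
    then have "A2 \<subseteq> A1" using \<open>B1 \<subseteq> B2\<close> basis_sub by blast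
    then show ?thesis using A basis_antichain by auto
  qed
  show "\<exists>B\<in>(-) E ` Bs. X \<subseteq> B \<and> Y \<subseteq> E - B"
    if hyp: "B1 \<in> (-) E ` Bs" "B2 \<in> (-) E ` Bs" "X \<subseteq> B1" "Y \<subseteq> E - B2" "X \<inter> Y = {}"
    for B1 B2 X Y
  proof -
    obtain A1 A2 where A: "A1 \<in> Bs" "A2 \<in> Bs" "B1 = E - A1" "B2 = E - A2"
      using hyp(1,2) by auto
    have "Y \<subseteq> A2" using A(4) hyp(4) by auto
    moreover have "X \<subseteq> E - A1" using A(3) hyp(3) by simp
    ultimately obtain B where "B \<in> Bs" "Y \<subseteq> B" "X \<subseteq> E - B"
      using basis_between[of A2 A1 Y X] A hyp(5) by auto
    moreover have "E - (E - B) = B" using basis_sub[of B] \<open>B \<in> Bs\<close> by blast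
    ultimately show ?thesis by auto
  qed
  show "(\<exists>B\<in>(-) E ` Bs. Y \<subseteq> E - B) \<or> (\<exists>C\<in>Cs. C \<subseteq> Y)" if "Y \<subseteq> E" for Y
    using basis_or_circuit[OF that] that basis_sub by auto
  show "(\<exists>B\<in>(-) E ` Bs. X \<subseteq> B) \<or> (\<exists>D\<in>Ds. D \<subseteq> X)" if "X \<subseteq> E" for X
    using cobasis_or_cocircuit[OF that] by auto
  show "\<exists>D\<in>Ds. e \<in> D \<and> D \<subseteq> insert e B" if "B \<in> (-) E ` Bs" "e \<in> E - B" for B e
    using that ex_fund_cocircuit by auto
  show "\<exists>C\<in>Cs. e \<in> C \<and> C \<subseteq> insert e (E - B)" if "B \<in> (-) E ` Bs" "e \<in> B" for B e
  proof -
    obtain A where A: "A \<in> Bs" "B = E - A" using \<open>B \<in> (-) E ` Bs\<close> by blast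
    then have "E - B = A" using basis_sub by blast
    then show ?thesis using ex_fund_circuit[OF A(1), of e] A that by auto
  qed
  show "dot E (d D) (c C) = 0" if "D \<in> Ds" "C \<in> Cs" for C D
    using circuit_cocircuit_orth that dot_commute by metis
qed (fact circuit_sub cocircuit_sub circuit_supp cocircuit_supp circuit_weight cocircuit_weight)+

text \<open>These are the kernel and the row space of the representing matrix, recovered from the
  signed circuits and cocircuits alone.\<close>
abbreviation flows where "flows \<equiv> ann E Ds d"
abbreviation tensions where "tensions \<equiv> ann E Cs c"

lemma circuit_flow: "C \<in> Cs \<Longrightarrow> c C \<in> flows"
  by (simp add: ann_def circuit_cocircuit_orth)

lemma ex_basis: "Bs \<noteq> {}"
proof
  assume "Bs = {}"
  then obtain C where C: "C \<in> Cs" "C \<subseteq> {}" using basis_or_circuit[of "{}"] by auto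
  then have "dot E w (c C) = 0"
    using circuit_supp[of C] unfolding dot_def by (intro sum.neutral) auto
  then show False using circuit_weight[OF C(1)] by simp
qed

text \<open>Pair \<open>v\<close> with the fundamental cocircuit of \<open>e\<close>: only the coordinate \<open>e\<close> survives.\<close>
lemma flow_zero_off_basis:
  assumes "B \<in> Bs" "v \<in> flows" "\<And>e. e \<in> E - B \<Longrightarrow> v e = 0" "e \<in> E"
  shows "v e = 0"
proof (cases "e \<in> B")
  case True
  then obtain D where D: "D \<in> Ds" "e \<in> D" "D \<subseteq> insert e (E - B)"
    using ex_fund_cocircuit assms(1) by blast
  have "dot E v (d D) = v e * d D e"
    using D finite_E assms cocircuit_supp[of D] by (intro dot_single) auto
  then show ?thesis using D assms(2) cocircuit_supp[of D e] by (simp add: ann_def)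
qed (use assms in auto)

text \<open>The fundamental circuits of \<open>B\<close> form a basis of the flows, dual to the coordinates off \<open>B\<close>. The
  orthogonality to all tensions is recorded because the flow is a combination of circuits; it is
  what makes the two spaces orthogonal in the next lemma.\<close>
lemma ex_flow_extending:
  assumes B: "B \<in> Bs"
  shows "\<exists>v\<in>flows. (\<forall>z\<in>tensions. dot E v z = 0) \<and> (\<forall>e\<in>E - B. v e = g e)"
proof -
  have "\<forall>e\<in>E - B. \<exists>C\<in>Cs. e \<in> C \<and> C \<subseteq> insert e B"
    using ex_fund_circuit[OF B] by blast
  then obtain F where F: "\<And>e. e \<in> E - B \<Longrightarrow> F e \<in> Cs \<and> e \<in> F e \<and> F e \<subseteq> insert e B"
    by metis
  let ?v = "\<lambda>e. \<Sum>f\<in>E - B. (g f / c (F f) f) * c (F f) e"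
  show ?thesis
  proof (intro bexI[of _ ?v] conjI ballI)
    show "?v \<in> flows"
      using F circuit_flow by (intro ann_sum ann_linear) auto
    show "dot E ?v z = 0" if "z \<in> tensions" for z
    proof -
      have "dot E (c (F f)) z = 0" if "f \<in> E - B" for f
        using F[OF that] annD[OF \<open>z \<in> tensions\<close>] dot_commute by metis
      then show ?thesis by (simp add: dot_sum_left dot_linear)
    qed
    show "?v e = g e" if e: "e \<in> E - B" for e
    proof -
      have "c (F f) e = 0" if "f \<in> E - B" "f \<noteq> e" for f
        using F[OF that(1)] circuit_supp[of "F f" e] e that by blast
      then have "?v e = (\<Sum>f\<in>{e}. (g f / c (F f) f) * c (F f) e)"
        using e finite_E by (intro sum.mono_neutral_right) auto
      also have "\<dots> = g e" using F[OF e] circuit_supp[of "F e" e] by simp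
      finally show ?thesis .
    qed
  qed
qed

lemma flow_tension_orth:
  assumes "v \<in> flows" "z \<in> tensions"
  shows "dot E v z = 0"
proof -
  obtain B where B: "B \<in> Bs" using ex_basis by blast
  obtain u where u: "u \<in> flows" "\<forall>z\<in>tensions. dot E u z = 0" "\<forall>e\<in>E - B. u e = v e"
    using ex_flow_extending[OF B, of v] by blast
  have "v e - u e = 0" if "e \<in> E" for e
    using flow_zero_off_basis[OF B ann_linear(2)[OF assms(1) u(1)] _ that] u(3) by auto
  then have "dot E v z = dot E u z" by (intro dot_cong) simp
  then show ?thesis using u(2) assms(2) by simp
qed

text \<open>So each of the two spaces is the full orthogonal complement of the other.\<close>
lemma tension_if_orth:
  assumes "\<And>v. v \<in> flows \<Longrightarrow> dot E v z = 0"
  shows "z \<in> tensions"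
  using assms[OF circuit_flow] dot_commute[of E z] by (simp add: ann_def)

lemma support_contains_circuit:
  assumes "v \<in> flows" "e \<in> E" "v e \<noteq> 0"
  obtains C where "C \<in> Cs" "C \<subseteq> {e\<in>E. v e \<noteq> 0}"
proof -
  have "\<not> {e\<in>E. v e \<noteq> 0} \<subseteq> B" if "B \<in> Bs" for B
    using flow_zero_off_basis[OF that assms(1), of e] assms by blast
  then show ?thesis using basis_or_circuit[of "{e\<in>E. v e \<noteq> 0}"] that by blast
qed

lemma circuit_nonempty: "C \<in> Cs \<Longrightarrow> \<exists>e\<in>E. e \<in> C"
proof (rule ccontr)
  assume C: "C \<in> Cs" "\<not> (\<exists>e\<in>E. e \<in> C)"
  then have "dot E w (c C) = 0"
    using circuit_supp[of C] unfolding dot_def by (intro sum.neutral) auto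
  then show False using circuit_weight[OF C(1)] by simp
qed

text \<open>Uniqueness of fundamental circuits is read off from the flows: a flow supported on a basis
  vanishes. The same argument then covers fundamental cocircuits, without the dual matroid.\<close>
lemma fund_circuit_mem:
  assumes B: "B \<in> Bs" and C: "C \<in> Cs" "C \<subseteq> insert e B"
  shows "e \<in> C"
proof (rule ccontr)
  assume "e \<notin> C"
  then have "\<forall>f\<in>E - B. c C f = 0" using C circuit_supp by blast
  then have "c C f = 0" if "f \<in> E" for f
    using flow_zero_off_basis[OF B circuit_flow[OF C(1)] _ that] by blast
  then show False using circuit_nonempty[OF C(1)] circuit_supp[OF C(1)] by blast
qed

lemma fund_circuit_unique:
  assumes B: "B \<in> Bs" and C1: "C1 \<in> Cs" "C1 \<subseteq> insert e B" and C2: "C2 \<in> Cs" "C2 \<subseteq> insert e B"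
  shows "C1 = C2"
proof -
  have e: "e \<in> C1" "e \<in> C2" using fund_circuit_mem[OF B] C1 C2 by blast+
  then have nz: "c C1 e \<noteq> 0" "c C2 e \<noteq> 0" using C1(1) C2(1) circuit_supp by blast+
  define v where "v f = c C1 f - (c C1 e / c C2 e) * c C2 f" for f
  have v: "v \<in> flows"
    unfolding v_def using C1(1) C2(1) circuit_flow by (simp add: ann_linear)
  have off: "v f = 0" if "f \<in> E - B" for f
  proof (cases "f = e")
    case True
    then show ?thesis using nz by (simp add: v_def)
  next
    case False
    then have "f \<notin> C1" "f \<notin> C2" using that C1(2) C2(2) by blast+
    then have "c C1 f = 0" "c C2 f = 0" using C1(1) C2(1) circuit_supp by blast+
    then show ?thesis by (simp add: v_def)
  qed
  have "f \<in> C1 \<longleftrightarrow> f \<in> C2" if "f \<in> E" for f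
  proof -
    have "v f = 0" by (rule flow_zero_off_basis[OF B v off that])
    then have "c C1 f = (c C1 e / c C2 e) * c C2 f" by (simp add: v_def)
    then have "c C1 f \<noteq> 0 \<longleftrightarrow> c C2 f \<noteq> 0" using nz by simp
    then show ?thesis using circuit_supp C1(1) C2(1) by blast
  qed
  then show ?thesis using circuit_sub C1(1) C2(1) by blast
qed

lemma the_fund_circuit:
  assumes "B \<in> Bs" "C \<in> Cs" "C \<subseteq> insert e B"
  shows "(THE C. C \<in> Cs \<and> C \<subseteq> insert e B) = C"
proof (rule the_equality)
  show "C' = C" if "C' \<in> Cs \<and> C' \<subseteq> insert e B" for C'
    using fund_circuit_unique[OF assms(1) _ _ assms(2,3)] that by simp
qed (use assms in simp)

text \<open>A conformal flow contains a conformal circuit. Take any circuit in the support and subtract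
  a multiple of it by the ratio test; either the remainder is nonzero with smaller support, or the flow
  was a multiple of that circuit.\<close>
lemma conformal_circuit:
  assumes s: "\<And>e. e \<in> E \<Longrightarrow> s e \<noteq> 0"
  assumes "v \<in> flows" "conformal E s v" "p \<in> E" "v p \<noteq> 0"
  shows "\<exists>C\<in>Cs. \<exists>a\<in>{-1, 1}. C \<subseteq> {e\<in>E. v e \<noteq> 0} \<and> (\<forall>e\<in>C. 0 < s e * (a * c C e))"
  using assms(2-)
proof (induction "card {e\<in>E. v e \<noteq> 0}" arbitrary: v p rule: less_induct)
  case less
  let ?S = "{e\<in>E. v e \<noteq> 0}"
  obtain C where C: "C \<in> Cs" "C \<subseteq> ?S"
    by (rule support_contains_circuit[OF less.prems(1,3,4)])
  obtain q where q: "q \<in> E" "q \<in> C" using circuit_nonempty C by blast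
  have sc: "s q * c C q \<noteq> 0" using s q circuit_supp[OF C(1)] by simp
  define a :: real where "a = (if 0 < s q * c C q then 1 else - 1)"
  have a: "a \<in> {-1, 1}" "0 < s q * (a * c C q)" using sc by (auto simp: a_def not_less order_le_less)
  obtain t where t: "0 < t" "conformal E s (\<lambda>e. v e - t * (a * c C e))"
    "{e\<in>E. v e - t * (a * c C e) \<noteq> 0} \<subset> ?S"
  proof (rule conformal_pivot[OF finite_E less.prems(2), of "\<lambda>e. a * c C e" q])
    show "v e \<noteq> 0" if "e \<in> E" "a * c C e \<noteq> 0" for e
      using that C circuit_supp[OF C(1), of e] by auto
  qed (use q a s in auto)
  let ?u = "\<lambda>e. v e - t * (a * c C e)"
  show ?case
  proof (cases "\<exists>e\<in>E. ?u e \<noteq> 0")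
    case False
    have "0 < s e * (a * c C e)" if e: "e \<in> C" for e
    proof -
      have eE: "e \<in> E" "v e \<noteq> 0" using C e by auto
      then have "v e = t * (a * c C e)" using False by auto
      moreover have "0 < s e * v e"
        using less.prems(2) eE s[of e] by (simp add: conformal_def order_less_le)
      ultimately have "0 < t * (s e * (a * c C e))" by (simp add: mult_ac)
      then show ?thesis using t(1) by (simp add: zero_less_mult_iff)
    qed
    then show ?thesis using C a by blast
  next
    case True
    then obtain p' where p': "p' \<in> E" "?u p' \<noteq> 0" by blast
    have "card {e\<in>E. ?u e \<noteq> 0} < card ?S"
      using t(3) finite_E by (intro psubset_card_mono) auto
    moreover have "?u \<in> flows"
      using less.prems(1) circuit_flow[OF C(1)] by (intro ann_linear)
    ultimately have "\<exists>C\<in>Cs. \<exists>a\<in>{-1, 1}. C \<subseteq> {e\<in>E. ?u e \<noteq> 0} \<and> (\<forall>e\<in>C. 0 < s e * (a * c C e))"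
      using less.hyps[of ?u p'] t(2) p' by blast
    then show ?thesis using t(3) by blast
  qed
qed

text \<open>No signed circuit or cocircuit that agrees with \<open>s\<close> is the negative of the chosen one.\<close>
definition compat :: "('e \<Rightarrow> real) \<Rightarrow> bool" where
  "compat s \<longleftrightarrow> (\<forall>e\<in>E. s e \<noteq> 0) \<and> (\<forall>C\<in>Cs. \<exists>e\<in>C. 0 < s e * c C e) \<and> (\<forall>D\<in>Ds. \<exists>e\<in>D. 0 < s e * d D e)"

lemma compat_dual: "oriented_pair.compat E Ds Cs d c s \<longleftrightarrow> compat s"
  unfolding oriented_pair.compat_def[OF dual_pair] compat_def by blast

lemma compat_nonzero: "compat s \<Longrightarrow> e \<in> E \<Longrightarrow> s e \<noteq> 0"
  by (simp add: compat_def)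

lemma compat_conformal_circuit:
  assumes "compat s" "v \<in> flows" "conformal E s v" "p \<in> E" "v p \<noteq> 0"
  obtains C where "C \<in> Cs" "C \<subseteq> {e\<in>E. v e \<noteq> 0}" "\<And>e. e \<in> C \<Longrightarrow> 0 < s e * c C e"
proof -
  obtain C a where C: "C \<in> Cs" "a \<in> {-1, 1}" "C \<subseteq> {e\<in>E. v e \<noteq> 0}"
    "\<And>e. e \<in> C \<Longrightarrow> 0 < s e * (a * c C e)"
    using conformal_circuit[OF compat_nonzero[OF assms(1)] assms(2-)] by blast
  obtain e where e: "e \<in> C" "0 < s e * c C e"
    using assms(1) C(1) unfolding compat_def by blast
  then have "a = 1" using C(2) C(4)[OF e(1)] by auto
  then show ?thesis using C that[of C] by auto
qed

text \<open>The linear program of a compatible \<open>s\<close> is bounded: by repeated ratio tests a conformal flow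
  is a nonnegative combination of conformal circuits, and by compatibility these are the chosen
  ones, which have positive weight. By the dual statement the program is feasible.\<close>
lemma compat_weight_nonneg:
  assumes "compat s" "v \<in> flows" "conformal E s v"
  shows "0 \<le> dot E w v"
  using assms(2,3)
proof (induction "card {e\<in>E. v e \<noteq> 0}" arbitrary: v rule: less_induct)
  case less
  show ?case
  proof (cases "\<exists>p\<in>E. v p \<noteq> 0")
    case False
    then have "dot E w v = 0" unfolding dot_def by (intro sum.neutral) auto
    then show ?thesis by simp
  next
    case True
    then obtain p where p: "p \<in> E" "v p \<noteq> 0" by blast
    obtain C where C: "C \<in> Cs" "C \<subseteq> {e\<in>E. v e \<noteq> 0}" "\<And>e. e \<in> C \<Longrightarrow> 0 < s e * c C e"
      using compat_conformal_circuit[OF assms(1) less.prems p] by blast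
    obtain q where q: "q \<in> E" "q \<in> C" using circuit_nonempty C by blast
    obtain t where t: "0 < t" "conformal E s (\<lambda>e. v e - t * c C e)"
      "{e\<in>E. v e - t * c C e \<noteq> 0} \<subset> {e\<in>E. v e \<noteq> 0}"
    proof (rule conformal_pivot[OF finite_E less.prems(2), of "c C" q])
      show "v e \<noteq> 0" if "e \<in> E" "c C e \<noteq> 0" for e
        using that C circuit_supp[OF C(1), of e] by auto
    qed (use q C compat_nonzero[OF assms(1)] in auto)
    have "card {e\<in>E. v e - t * c C e \<noteq> 0} < card {e\<in>E. v e \<noteq> 0}"
      using t(3) finite_E by (intro psubset_card_mono) auto
    moreover have "(\<lambda>e. v e - t * c C e) \<in> flows"
      using less.prems(1) circuit_flow[OF C(1)] by (intro ann_linear)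
    ultimately have "0 \<le> dot E w (\<lambda>e. v e - t * c C e)"
      using less.hyps[of "\<lambda>e. v e - t * c C e"] t(2) by blast
    moreover have "0 < t * dot E w (c C)" using t(1) circuit_weight[OF C(1)] by simp
    ultimately show ?thesis by (simp add: dot_linear)
  qed
qed

section \<open>Linear programming duality and bases\<close>

text \<open>Complementary optimal solutions of the program \<open>min \<langle>w, x\<rangle>\<close>, \<open>x \<in> w' + flows\<close>, \<open>x\<close> conformal to \<open>s\<close>
  and of its dual, from Minty's lemma applied to the self-dual homogenisation of Goldman and
  Tucker. For \<open>x = t w' + v\<close> and \<open>y = t w + z\<close> one has
  \<open>\<langle>x, y\<rangle> = t (t \<langle>w, w'\<rangle> + \<langle>w', z\<rangle> + \<langle>w, v\<rangle>)\<close>, so the duality gap divided by \<open>t\<close> is linear in \<open>(t, v, z)\<close>,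
  and its negative can serve as an additional coordinate.\<close>
lemma strong_duality:
  assumes s: "compat s"
  obtains x y where "(\<lambda>e. x e - w' e) \<in> flows" "(\<lambda>e. y e - w e) \<in> tensions"
    "\<And>e. e \<in> E \<Longrightarrow> 0 \<le> s e * x e" "\<And>e. e \<in> E \<Longrightarrow> 0 \<le> s e * y e"
    "\<And>e. e \<in> E \<Longrightarrow> x e * y e = 0"
proof -
  note nz = compat_nonzero[OF s]
  \<comment> \<open>The coordinates are \<open>s x\<close>, \<open>s y\<close>, the homogenising variable \<open>t\<close> and the negative of the gap.\<close>
  define \<phi> where "\<phi> t v z = case_sum (case_sum (\<lambda>e. s e * (t * w' e + v e)) (\<lambda>e. s e * (t * w e + z e)))
      (\<lambda>b. if b then t else - (t * dot E w w' + dot E w' z + dot E w v))"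
    for t :: real and v z
  define U where "U = {\<phi> t v z | t v z. v \<in> flows \<and> z \<in> tensions}"
  define I where "I = (E <+> E) <+> {True, False}"
  have finI: "finite I" "Inr True \<in> I" using finite_E by (auto simp: I_def)
  have inI: "Inl (Inl e) \<in> I" "Inl (Inr e) \<in> I" if "e \<in> E" for e
    using that by (auto simp: I_def)
  have inI': "Inr b \<in> I" for b by (cases b) (auto simp: I_def)
  have closed: "lincomb_closed U"
    unfolding lincomb_closed_def
  proof (intro ballI allI)
    fix p q a b assume "p \<in> U" "q \<in> U"
    then obtain t v z t' v' z' where
      p: "p = \<phi> t v z" "v \<in> flows" "z \<in> tensions" and q: "q = \<phi> t' v' z'" "v' \<in> flows" "z' \<in> tensions"
      unfolding U_def by blast
    have "(\<lambda>i. a * p i + b * q i) = \<phi> (a * t + b * t') (\<lambda>e. a * v e + b * v' e) (\<lambda>e. a * z e + b * z' e)"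
      by (rule ext) (auto simp: p q \<phi>_def dot_linear algebra_simps split: sum.split)
    moreover have "(\<lambda>e. a * v e + b * v' e) \<in> flows" "(\<lambda>e. a * z e + b * z' e) \<in> tensions"
      using p q by (simp_all add: ann_linear)
    ultimately show "(\<lambda>i. a * p i + b * q i) \<in> U" unfolding U_def by blast
  qed
  show ?thesis
    using finI closed
  proof (cases rule: minty[of I "Inr True" U])
    case (primal u)
    then obtain t v z where u: "u = \<phi> t v z" and v: "v \<in> flows" and z: "z \<in> tensions"
      unfolding U_def by blast
    have t: "0 < t" using primal(3) by (simp add: u \<phi>_def)
    define x where "x e = w' e + v e / t" for e
    define y where "y e = w e + z e / t" for e
    have x: "0 \<le> s e * x e" if "e \<in> E" for e
    proof -
      have "0 \<le> s e * (t * w' e + v e)"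
        using primal(2)[OF inI(1)[OF that]] by (simp add: u \<phi>_def)
      also have "\<dots> = t * (s e * x e)" using t by (simp add: x_def field_simps)
      finally show ?thesis using t by (simp only: zero_le_mult_iff) linarith
    qed
    have y: "0 \<le> s e * y e" if "e \<in> E" for e
    proof -
      have "0 \<le> s e * (t * w e + z e)"
        using primal(2)[OF inI(2)[OF that]] by (simp add: u \<phi>_def)
      also have "\<dots> = t * (s e * y e)" using t by (simp add: y_def field_simps)
      finally show ?thesis using t by (simp only: zero_le_mult_iff) linarith
    qed
    have gap: "t * dot E w w' + dot E w' z + dot E w v \<le> 0"
      using primal(2)[OF inI'[of False]] by (simp add: u \<phi>_def)
    have "t * dot E x y = t * dot E w w' + dot E w' z + dot E w v"
      unfolding x_def y_def using flow_tension_orth[OF v z] t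
      by (simp add: dot_linear dot_commute[of E w' w] dot_commute[of E v w] field_simps)
    with gap have "t * dot E x y \<le> 0" by simp
    then have "dot E x y \<le> 0" using t by (meson mult_pos_pos not_less)
    then have "x e * y e = 0" if "e \<in> E" for e
      using conformal_dot_nonpos_disjoint[of E s x y e] finite_E x y nz that
      by (simp add: conformal_def)
    moreover have "(\<lambda>e. x e - w' e) \<in> flows" "(\<lambda>e. y e - w e) \<in> tensions"
      using v z by (simp_all add: x_def y_def ann_linear)
    ultimately show ?thesis using that x y by blast
  next
    case (dual \<psi>)
    \<comment> \<open>An orthogonal vector is, after dividing by \<open>q\<close>, again a feasible pair, now with a negative
      gap; for \<open>q = 0\<close> it is a ray that contradicts boundedness or feasibility.\<close>
    define a where "a e = s e * \<psi> (Inl (Inl e))" for e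
    define b where "b e = s e * \<psi> (Inl (Inr e))" for e
    define p where "p = \<psi> (Inr True)"
    define q where "q = \<psi> (Inr False)"
    have p: "0 < p" and q: "0 \<le> q" using dual(2)[OF inI'[of False]] dual(3)
      by (auto simp: p_def q_def)
    have a: "conformal E s a" and b: "conformal E s b"
      using dual(2)[OF inI(1)] dual(2)[OF inI(2)]
    by (simp_all add: conformal_def a_def b_def mult.assoc[symmetric])
    have key: "t * dot E w' a + dot E v a + t * dot E w b + dot E z b + t * p
        - q * (t * dot E w w' + dot E w' z + dot E w v) = 0"
      if "v \<in> flows" "z \<in> tensions" for t v z
    proof -
      have orth: "dot I (\<phi> t v z) \<psi> = 0" using dual(1) that unfolding U_def by blast
      define g where "g = t * dot E w w' + dot E w' z + dot E w v"
      have "\<phi> t v z (Inr False) = - g" by (simp add: \<phi>_def g_def)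
      then have "dot I (\<phi> t v z) \<psi> = (\<Sum>e\<in>E. s e * (t * w' e + v e) * \<psi> (Inl (Inl e)))
          + (\<Sum>e\<in>E. s e * (t * w e + z e) * \<psi> (Inl (Inr e))) + t * p - q * g"
        using finite_E unfolding dot_def I_def p_def q_def
        by (simp add: sum.Plus) (simp add: \<phi>_def mult.commute)
      moreover have "(\<Sum>e\<in>E. s e * (t * w' e + v e) * \<psi> (Inl (Inl e))) = t * dot E w' a + dot E v a"
        unfolding dot_def a_def sum_distrib_left sum.distrib[symmetric]
        by (intro sum.cong refl) (simp add: algebra_simps)
      moreover have "(\<Sum>e\<in>E. s e * (t * w e + z e) * \<psi> (Inl (Inr e))) = t * dot E w b + dot E z b"
        unfolding dot_def b_def sum_distrib_left sum.distrib[symmetric]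
        by (intro sum.cong refl) (simp add: algebra_simps)
      ultimately show ?thesis using orth unfolding g_def by simp
    qed
    have aw: "(\<lambda>e. a e - q * w e) \<in> tensions"
    proof (rule tension_if_orth)
      fix v assume "v \<in> flows"
      then have "dot E v a - q * dot E w v = 0"
        using key[OF _ ann_linear(6), of v 0] by simp
      then show "dot E v (\<lambda>e. a e - q * w e) = 0"
        by (simp add: dot_linear dot_commute[of E w v])
    qed
    have bw: "(\<lambda>e. b e - q * w' e) \<in> flows"
    proof (rule oriented_pair.tension_if_orth[OF dual_pair])
      fix z assume "z \<in> tensions"
      then have "dot E z b - q * dot E w' z = 0"
        using key[OF ann_linear(6), of z 0] by simp
      then show "dot E z (\<lambda>e. b e - q * w' e) = 0"
        by (simp add: dot_linear dot_commute[of E w' z])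
    qed
    have c1: "dot E w' a + dot E w b + p - q * dot E w w' = 0"
      using key[OF ann_linear(6) ann_linear(6), of 1] by simp
    show ?thesis
    proof (cases "q = 0")
      case True
      have "0 \<le> dot E w b" using compat_weight_nonneg[OF s _ b] bw True by simp
      moreover have "0 \<le> dot E w' a"
        using oriented_pair.compat_weight_nonneg[OF dual_pair, of s a] s compat_dual a aw True by simp
      ultimately show ?thesis using c1 p True by simp
    next
      case False
      have "dot E (\<lambda>e. b e - q * w' e) (\<lambda>e. a e - q * w e) = 0"
        using flow_tension_orth[OF bw aw] .
      then have "dot E a b - q * dot E w b - q * (dot E w' a) + q * (q * dot E w w') = 0"
        by (simp add: dot_linear dot_commute[of E b a] dot_commute[of E b w] dot_commute[of E w' w] algebra_simps)
      moreover have "q * (dot E w' a + dot E w b + p - q * dot E w w') = 0" using c1 by simp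
      ultimately have "dot E a b + q * p = 0" by (simp add: algebra_simps)
      moreover have "0 \<le> dot E a b" using conformal_dot_nonneg[OF a b nz] .
      moreover have "0 < q * p" using p q False by simp
      ultimately show ?thesis by linarith
    qed
  qed
qed

text \<open>The orientation that \<open>B\<close> obtains from its fundamental circuits and cocircuits is \<open>s\<close>. Circuits
  \<open>C \<subseteq> insert e B\<close> are fundamental by uniqueness.\<close>
definition induces :: "'e set \<Rightarrow> ('e \<Rightarrow> real) \<Rightarrow> bool" where
  "induces B s \<longleftrightarrow>
    (\<forall>e\<in>E - B. \<forall>C\<in>Cs. C \<subseteq> insert e B \<longrightarrow> 0 < s e * c C e) \<and>
    (\<forall>e\<in>B. \<forall>D\<in>Ds. D \<subseteq> insert e (E - B) \<longrightarrow> 0 < s e * d D e)"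

lemma induces_dual:
  "B \<in> Bs \<Longrightarrow> oriented_pair.induces E Ds Cs d c (E - B) s \<longleftrightarrow> induces B s"
proof -
  assume "B \<in> Bs"
  then have "E - (E - B) = B" using basis_sub by blast
  then show ?thesis unfolding oriented_pair.induces_def[OF dual_pair] induces_def by auto
qed

lemma dot_circuit_eq_weight:
  assumes "(\<lambda>e. y e - w e) \<in> tensions" "C \<in> Cs"
  shows "dot E y (c C) = dot E w (c C)"
  using annD[OF assms] by (simp add: dot_linear)

text \<open>Nondegeneracy: the weight of a circuit is nonzero, so dual solutions cannot vanish on it.\<close>
lemma tension_translate_nonzero_on_circuit:
  assumes "(\<lambda>e. y e - w e) \<in> tensions" "C \<in> Cs"
  shows "\<exists>e\<in>C. y e \<noteq> 0"
proof (rule ccontr)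
  assume "\<not> ?thesis"
  then have "dot E y (c C) = 0"
    using circuit_supp[OF assms(2)] unfolding dot_def by (intro sum.neutral) auto
  then show False using dot_circuit_eq_weight[OF assms] circuit_weight[OF assms(2)] by simp
qed

lemma sign_agrees:
  fixes a b g :: real
  assumes "0 \<le> a * b" "0 < b * g" "a \<noteq> 0"
  shows "0 < a * g"
  using assms by (auto simp: zero_le_mult_iff zero_less_mult_iff)

lemma fund_circuit_sign:
  assumes "(\<lambda>e. y e - w e) \<in> tensions" "\<And>f. f \<in> B \<Longrightarrow> y f = 0"
    and "C \<in> Cs" "C \<subseteq> insert e B" "e \<in> E"
  shows "0 < y e * c C e"
proof -
  have "dot E y (c C) = y e * c C e"
    using assms finite_E circuit_supp[OF assms(3)] by (intro dot_single) auto
  then show ?thesis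
    using dot_circuit_eq_weight[OF assms(1,3)] circuit_weight[OF assms(3)] by simp
qed

text \<open>The supports of complementary optimal solutions are disjoint, contain no circuit
  (respectively cocircuit) by nondegeneracy, and hence lie on the two sides of some basis \<open>B\<close>. On
  the fundamental (co)circuits of \<open>B\<close> the weights \<open>w\<close>, \<open>w'\<close> may be replaced by the solutions, which
  have a single nonzero coordinate there; its sign is that of \<open>s\<close>.\<close>
lemma compat_induced_by_basis:
  assumes s: "compat s"
  shows "\<exists>B\<in>Bs. induces B s"
proof -
  obtain x y where x: "(\<lambda>e. x e - w' e) \<in> flows" and y: "(\<lambda>e. y e - w e) \<in> tensions"
    and sx: "\<And>e. e \<in> E \<Longrightarrow> 0 \<le> s e * x e" and sy: "\<And>e. e \<in> E \<Longrightarrow> 0 \<le> s e * y e"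
    and xy: "\<And>e. e \<in> E \<Longrightarrow> x e * y e = 0"
    using strong_duality[OF s] by blast
  let ?X = "{e\<in>E. x e \<noteq> 0}" and ?Y = "{e\<in>E. y e \<noteq> 0}"
  have "\<not> C \<subseteq> ?X" if "C \<in> Cs" for C
    using tension_translate_nonzero_on_circuit[OF y that] xy by auto
  then obtain B1 where B1: "B1 \<in> Bs" "?X \<subseteq> B1" using basis_or_circuit[of ?X] by auto
  have "\<not> D \<subseteq> ?Y" if "D \<in> Ds" for D
    using oriented_pair.tension_translate_nonzero_on_circuit[OF dual_pair x that] xy by auto
  then obtain B2 where B2: "B2 \<in> Bs" "?Y \<subseteq> E - B2" using cobasis_or_cocircuit[of ?Y] by auto
  have "?X \<inter> ?Y = {}" using xy by auto
  then obtain B where B: "B \<in> Bs" "?X \<subseteq> B" "?Y \<subseteq> E - B"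
    using basis_between[OF B1(1) B2(1) B1(2) B2(2)] by blast
  have "0 < s e * c C e" if "e \<in> E - B" "C \<in> Cs" "C \<subseteq> insert e B" for e C
  proof -
    have "0 < y e * c C e"
      using that B basis_sub[OF B(1)] by (intro fund_circuit_sign[OF y, of B]) auto
    then show ?thesis using sign_agrees[of "s e" "y e" "c C e"] sy compat_nonzero[OF s] that by auto
  qed
  moreover have "0 < s e * d D e" if "e \<in> B" "D \<in> Ds" "D \<subseteq> insert e (E - B)" for e D
  proof -
    have e: "e \<in> E" using that basis_sub[OF B(1)] by auto
    have "0 < x e * d D e"
      using that B e by (intro oriented_pair.fund_circuit_sign[OF dual_pair x, of "E - B"]) auto
    then show ?thesis using sign_agrees[of "s e" "x e" "d D e"] sx compat_nonzero[OF s] e by auto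
  qed
  ultimately show ?thesis using B(1) unfolding induces_def by blast
qed

text \<open>Conversely, the basic solution of a basis that induces \<open>s\<close> is strictly feasible on \<open>B\<close>.\<close>
lemma basic_solution:
  assumes B: "B \<in> Bs" and s: "induces B s"
  shows "\<exists>x. (\<lambda>e. x e - w' e) \<in> flows \<and> (\<forall>e\<in>E - B. x e = 0) \<and> (\<forall>e\<in>B. 0 < s e * x e)"
proof -
  obtain v where v: "v \<in> flows" "\<forall>e\<in>E - B. v e = - w' e"
    using ex_flow_extending[OF B, of "\<lambda>e. - w' e"] by blast
  define x where "x e = w' e + v e" for e
  have x: "(\<lambda>e. x e - w' e) \<in> flows" "\<forall>e\<in>E - B. x e = 0" using v by (simp_all add: x_def)
  have "0 < s e * x e" if e: "e \<in> B" for e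
  proof -
    obtain D where D: "D \<in> Ds" "e \<in> D" "D \<subseteq> insert e (E - B)" using ex_fund_cocircuit B e by blast
    have "0 < x e * d D e"
      using D e x(2) basis_sub[OF B] by (intro oriented_pair.fund_circuit_sign[OF dual_pair x(1), of "E - B"]) auto
    moreover have "0 < s e * d D e" using s D e by (auto simp: induces_def)
    ultimately show ?thesis by (auto simp: zero_less_mult_iff)
  qed
  then show ?thesis using x by blast
qed

lemma basic_dual_solution:
  assumes B: "B \<in> Bs" and s: "induces B s"
  shows "\<exists>y. (\<lambda>e. y e - w e) \<in> tensions \<and> (\<forall>e\<in>B. y e = 0) \<and> (\<forall>e\<in>E - B. 0 < s e * y e)"
proof -
  have "E - (E - B) = B" using basis_sub[OF B] by blast
  then show ?thesis
    using oriented_pair.basic_solution[OF dual_pair, of "E - B" s] B s induces_dual[OF B] by auto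
qed

lemma induces_nonzero:
  assumes "B \<in> Bs" "induces B s" "e \<in> E"
  shows "s e \<noteq> 0"
  using basic_solution[OF assms(1,2)] basic_dual_solution[OF assms(1,2)] assms(3) by force

text \<open>If \<open>s\<close> agreed with \<open>-c C\<close>, then pairing \<open>c C\<close> with the reduced costs would give
  a nonpositive value, but this value is the positive weight of \<open>C\<close>.\<close>
lemma induces_agrees_on_circuit:
  assumes B: "B \<in> Bs" and s: "induces B s" and C: "C \<in> Cs"
  shows "\<exists>e\<in>C. 0 < s e * c C e"
proof (rule ccontr)
  assume neg: "\<not> ?thesis"
  obtain y where y: "(\<lambda>e. y e - w e) \<in> tensions" "\<forall>e\<in>B. y e = 0" "\<forall>e\<in>E - B. 0 < s e * y e"
    using basic_dual_solution[OF B s] by blast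
  have "y e * c C e \<le> 0" if e: "e \<in> E" for e
  proof (cases "e \<in> C \<and> e \<notin> B")
    case True
    then have "0 < s e * y e" "s e * c C e \<le> 0" using y(3) neg e by auto
    then show ?thesis by (auto simp: zero_less_mult_iff mult_le_0_iff)
  next
    case False
    then show ?thesis using y(2) circuit_supp[OF C, of e] by auto
  qed
  then have "dot E y (c C) \<le> 0" unfolding dot_def by (rule sum_nonpos)
  then show False using dot_circuit_eq_weight[OF y(1) C] circuit_weight[OF C] by simp
qed

lemma induces_compat:
  assumes "B \<in> Bs" "induces B s"
  shows "compat s"
  using induces_nonzero[OF assms] induces_agrees_on_circuit[OF assms]
    oriented_pair.induces_agrees_on_circuit[OF dual_pair, of "E - B" s] assms induces_dual
  unfolding compat_def by blast

text \<open>Differences of basic solutions are flows and differences of reduced costs are tensions.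
  Expanding their product, the primal solution of each basis is complementary to the
  reduced costs of the other, and strict feasibility turns this into \<open>B1 \<subseteq> B2\<close>.\<close>
lemma induces_unique:
  assumes B: "B1 \<in> Bs" "B2 \<in> Bs" and s: "induces B1 s" "induces B2 s"
  shows "B1 = B2"
proof -
  obtain x1 where x1: "(\<lambda>e. x1 e - w' e) \<in> flows" "\<forall>e\<in>E - B1. x1 e = 0" "\<forall>e\<in>B1. 0 < s e * x1 e"
    using basic_solution[OF B(1) s(1)] by blast
  obtain x2 where x2: "(\<lambda>e. x2 e - w' e) \<in> flows" "\<forall>e\<in>E - B2. x2 e = 0" "\<forall>e\<in>B2. 0 < s e * x2 e"
    using basic_solution[OF B(2) s(2)] by blast
  obtain y1 where y1: "(\<lambda>e. y1 e - w e) \<in> tensions" "\<forall>e\<in>B1. y1 e = 0" "\<forall>e\<in>E - B1. 0 < s e * y1 e"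
    using basic_dual_solution[OF B(1) s(1)] by blast
  obtain y2 where y2: "(\<lambda>e. y2 e - w e) \<in> tensions" "\<forall>e\<in>B2. y2 e = 0" "\<forall>e\<in>E - B2. 0 < s e * y2 e"
    using basic_dual_solution[OF B(2) s(2)] by blast
  have conf: "conformal E s x1" "conformal E s x2" "conformal E s y1" "conformal E s y2"
    unfolding conformal_def using x1 x2 y1 y2 by (metis DiffI less_imp_le mult_zero_right order_refl)+
  note nz = induces_nonzero[OF B(1) s(1)]
  have "(\<lambda>e. (x1 e - w' e) - (x2 e - w' e)) \<in> flows" using x1(1) x2(1) by (rule ann_linear)
  then have dx: "(\<lambda>e. x1 e - x2 e) \<in> flows" by simp
  have "(\<lambda>e. (y1 e - w e) - (y2 e - w e)) \<in> tensions" using y1(1) y2(1) by (rule ann_linear)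
  then have dy: "(\<lambda>e. y1 e - y2 e) \<in> tensions" by simp
  have "dot E x1 y1 = 0" "dot E x2 y2 = 0"
    unfolding dot_def using x1 x2 y1 y2 by (auto intro!: sum.neutral)
  then have "dot E x1 y2 + dot E x2 y1 = 0"
    using flow_tension_orth[OF dx dy] by (simp add: dot_linear)
  moreover have "0 \<le> dot E x2 y1" using conformal_dot_nonneg[OF conf(2,3) nz] .
  ultimately have le: "dot E x1 y2 \<le> 0" by simp
  have "B1 \<subseteq> B2"
  proof
    fix e assume e: "e \<in> B1"
    then have eE: "e \<in> E" using basis_sub[OF B(1)] by auto
    have "x1 e * y2 e = 0"
      using conformal_dot_nonpos_disjoint[OF finite_E conf(1,4) nz le eE] .
    moreover have "x1 e \<noteq> 0" using x1(3) e by auto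
    ultimately have "y2 e = 0" by simp
    then show "e \<in> B2" using y2(3) eE by force
  qed
  then show ?thesis using basis_antichain B by blast
qed

section \<open>The cyclic and the acyclic part of an orientation\<close>
abbreviation cyc where "cyc \<equiv> conformal_part E flows"
abbreviation cocyc where "cocyc \<equiv> conformal_part E tensions"

lemma cyc_cocyc_disjoint:
  assumes nz: "\<And>e. e \<in> E \<Longrightarrow> s e \<noteq> 0" and v: "v \<in> flows" "conformal E s v"
    and z: "z \<in> tensions" "conformal E s z" and e: "e \<in> E"
  shows "v e * z e = 0"
  using conformal_dot_nonpos_disjoint[OF finite_E v(2) z(2) nz _ e] flow_tension_orth[OF v(1) z(1)]
  by simp

text \<open>Minty's lemma for the flows, after flipping the coordinates by the signs of \<open>s\<close>.\<close>
lemma cyc_eq: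
  assumes nz: "\<And>e. e \<in> E \<Longrightarrow> s e \<noteq> 0"
  shows "cyc s = E - cocyc s"
proof
  show "cyc s \<subseteq> E - cocyc s"
    using cyc_cocyc_disjoint[OF nz] by (fastforce simp: conformal_part_def)
  show "E - cocyc s \<subseteq> cyc s"
  proof
    fix k assume k: "k \<in> E - cocyc s"
    let ?U = "(\<lambda>v e. s e * v e) ` flows"
    have "lincomb_closed ?U"
      unfolding lincomb_closed_def
    proof safe
      fix u v a b assume "u \<in> flows" "v \<in> flows"
      then have "(\<lambda>e. a * u e + b * v e) \<in> flows" by (simp add: ann_linear)
      then show "(\<lambda>e. a * (s e * u e) + b * (s e * v e)) \<in> ?U"
        by (intro image_eqI[of _ _ "\<lambda>e. a * u e + b * v e"]) (auto simp: algebra_simps)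
    qed
    note closed = this
    have "k \<in> E" using k by simp
    with finite_E show "k \<in> cyc s"
      using closed
    proof (cases rule: minty[of E k ?U])
      case (primal u)
      obtain v where v: "v \<in> flows" "u = (\<lambda>e. s e * v e)" using primal(1) by blast
      then have "conformal E s v" "v k \<noteq> 0" using primal(2,3) by (auto simp: conformal_def)
      then show ?thesis using v(1) \<open>k \<in> E\<close> unfolding conformal_part_def by blast
    next
      case (dual z)
      have "(\<lambda>e. s e * z e) \<in> tensions"
      proof (rule tension_if_orth)
        fix v assume "v \<in> flows"
        then have "dot E (\<lambda>e. s e * v e) z = 0" using dual(1) by blast
        then show "dot E v (\<lambda>e. s e * z e) = 0" by (simp add: dot_def mult_ac)
      qed
      moreover have "conformal E s (\<lambda>e. s e * z e)"
        using dual(2) by (simp add: conformal_def mult.assoc[symmetric])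
      moreover have "s k * z k \<noteq> 0" using dual(3) nz \<open>k \<in> E\<close> by auto
      ultimately have "k \<in> cocyc s" using \<open>k \<in> E\<close> unfolding conformal_part_def by blast
      then show ?thesis using k by simp
    qed
  qed
qed

text \<open>A directed cocircuit is disjoint from every directed circuit, so reversing the latter does not
  affect it. Together with \<open>cyc_eq\<close> this makes both parts invariant under reversals.\<close>
lemma cocyc_reversal_subset:
  assumes nz: "\<And>e. e \<in> E \<Longrightarrow> s e \<noteq> 0"
    and v: "v \<in> flows" "conformal E s v" and eq: "\<And>e. e \<in> E \<Longrightarrow> v e = 0 \<Longrightarrow> s' e = s e"
  shows "cocyc s \<subseteq> cocyc s'"
proof
  fix e assume "e \<in> cocyc s"
  then obtain z where z: "z \<in> tensions" "conformal E s z" "z e \<noteq> 0" and e: "e \<in> E"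
    by (auto simp: conformal_part_def)
  have "conformal E s' z"
    unfolding conformal_def
  proof
    fix f assume f: "f \<in> E"
    show "0 \<le> s' f * z f"
    proof (cases "v f = 0")
      case True
      then show ?thesis using eq[OF f] z(2) f by (simp add: conformal_def)
    next
      case False
      then show ?thesis using cyc_cocyc_disjoint[OF nz v z(1,2) f] by simp
    qed
  qed
  then show "e \<in> cocyc s'" using z e by (auto simp: conformal_part_def)
qed

text \<open>The invariant of the reversal classes: the cyclic and acyclic parts agree, and the difference
  is a flow on the former plus a tension on the latter.\<close>
definition linked :: "('e \<Rightarrow> real) \<Rightarrow> ('e \<Rightarrow> real) \<Rightarrow> bool" where
  "linked s s' \<longleftrightarrow> cyc s = cyc s' \<and> cocyc s = cocyc s' \<and>
    (\<exists>v\<in>flows. \<exists>z\<in>tensions. (\<forall>e\<in>E. s e - s' e = v e + z e) \<and>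
      (\<forall>e\<in>E - cyc s. v e = 0) \<and> (\<forall>e\<in>E - cocyc s. z e = 0))"

lemma linked_if_dual_linked:
  assumes "oriented_pair.linked E Ds Cs d c s s'"
  shows "linked s s'"
proof -
  obtain z v where "z \<in> tensions" "v \<in> flows" "\<forall>e\<in>E. s e - s' e = z e + v e"
    "\<forall>e\<in>E - cocyc s. z e = 0" "\<forall>e\<in>E - cyc s. v e = 0"
    and "cyc s = cyc s'" "cocyc s = cocyc s'"
    using assms unfolding oriented_pair.linked_def[OF dual_pair] by blast
  then show ?thesis
    unfolding linked_def by (intro conjI bexI[of _ v] bexI[of _ z]) (simp_all add: add.commute)
qed

lemma linked_refl: "linked s s"
  unfolding linked_def using ann_linear(6) by (intro conjI refl bexI[of _ "\<lambda>e. 0"]) auto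

lemma linked_sym: "linked s s' \<Longrightarrow> linked s' s"
proof -
  assume l: "linked s s'"
  then obtain v z where "v \<in> flows" "z \<in> tensions" and e: "\<forall>e\<in>E. s e - s' e = v e + z e"
      "\<forall>e\<in>E - cyc s. v e = 0" "\<forall>e\<in>E - cocyc s. z e = 0"
    unfolding linked_def by blast
  then have vz: "(\<lambda>e. - v e) \<in> flows" "(\<lambda>e. - z e) \<in> tensions" by (simp_all add: ann_linear)
  have "\<forall>e\<in>E. s' e - s e = - v e + - z e" using e(1) by force
  then show ?thesis
    using l e(2,3) unfolding linked_def by (intro conjI bexI[OF _ vz(1)] bexI[OF _ vz(2)]) simp_all
qed

lemma linked_trans: "linked s s' \<Longrightarrow> linked s' s'' \<Longrightarrow> linked s s''"
proof -
  assume l: "linked s s'" "linked s' s''"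
  obtain v z where v: "v \<in> flows" "z \<in> tensions" and e: "\<forall>e\<in>E. s e - s' e = v e + z e"
      "\<forall>e\<in>E - cyc s. v e = 0" "\<forall>e\<in>E - cocyc s. z e = 0"
    using l(1) unfolding linked_def by blast
  obtain v' z' where v': "v' \<in> flows" "z' \<in> tensions" and e': "\<forall>e\<in>E. s' e - s'' e = v' e + z' e"
      "\<forall>e\<in>E - cyc s'. v' e = 0" "\<forall>e\<in>E - cocyc s'. z' e = 0"
    using l(2) unfolding linked_def by blast
  have vz: "(\<lambda>e. v e + v' e) \<in> flows" "(\<lambda>e. z e + z' e) \<in> tensions"
    using v v' by (simp_all add: ann_linear)
  have "\<forall>e\<in>E. s e - s'' e = (v e + v' e) + (z e + z' e)" using e(1) e'(1) by force
  then show ?thesis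
    using l e(2,3) e'(2,3) unfolding linked_def
    by (intro conjI bexI[OF _ vz(1)] bexI[OF _ vz(2)]) simp_all
qed

lemma linked_flow_reversal:
  assumes nz: "\<And>e. e \<in> E \<Longrightarrow> s e \<noteq> 0" "\<And>e. e \<in> E \<Longrightarrow> s' e \<noteq> 0"
    and v: "v \<in> flows" and diff: "\<And>e. e \<in> E \<Longrightarrow> s e - s' e = v e"
    and conf: "conformal E s v" "conformal E s' (\<lambda>e. - v e)"
  shows "linked s s'"
proof -
  have eq: "s' e = s e" if "e \<in> E" "v e = 0" for e using diff[of e] that by simp
  have "cocyc s = cocyc s'"
  proof
    show "cocyc s \<subseteq> cocyc s'" using nz(1) v conf(1) eq by (rule cocyc_reversal_subset)
    show "cocyc s' \<subseteq> cocyc s"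
      using cocyc_reversal_subset[OF nz(2) ann_linear(5)[OF v] conf(2), of s] eq by simp
  qed
  moreover from this have "cyc s = cyc s'" using cyc_eq nz by simp
  moreover have "\<forall>e\<in>E - cyc s. v e = 0" using v conf(1) by (auto simp: conformal_part_def)
  ultimately show ?thesis
    unfolding linked_def using diff ann_linear(6)
    by (intro conjI bexI[OF _ v] bexI[of _ "\<lambda>e. 0"]) auto
qed

text \<open>Where \<open>v\<close> is nonzero, \<open>s\<close> and \<open>s'\<close> are opposite and \<open>v\<close> has the sign of \<open>s\<close>. A circuit inside \<open>v\<close>
  is thus directed in both, in opposite directions, and one of the directions is not the chosen
  one.\<close>
lemma linked_compat_flow_zero:
  assumes s: "compat s" "compat s'"
    and pm: "\<And>e. e \<in> E \<Longrightarrow> s e \<in> {-1, 1}" "\<And>e. e \<in> E \<Longrightarrow> s' e \<in> {-1, 1}"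
    and v: "v \<in> flows" and diff: "\<And>e. e \<in> E \<Longrightarrow> v e \<noteq> 0 \<Longrightarrow> v e = s e - s' e"
    and p: "p \<in> E"
  shows "v p = 0"
proof (rule ccontr)
  assume vp: "v p \<noteq> 0"
  have "conformal E s v"
    unfolding conformal_def
  proof
    fix e assume e: "e \<in> E"
    show "0 \<le> s e * v e" using pm[OF e] diff[OF e] by (cases "v e = 0") auto
  qed
  then obtain C where C: "C \<in> Cs" "C \<subseteq> {e\<in>E. v e \<noteq> 0}" "\<And>e. e \<in> C \<Longrightarrow> 0 < s e * c C e"
    using compat_conformal_circuit[OF s(1) v _ p vp] by blast
  obtain e where e: "e \<in> C" "0 < s' e * c C e"
    using s(2) C(1) unfolding compat_def by blast
  have "e \<in> E" "s e \<noteq> s' e" using C(2) e(1) diff[of e] by auto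
  then have "s' e = - s e" using pm[of e] by auto
  then show False using C(3)[OF e(1)] e(2) by simp
qed

lemma linked_compat_eq:
  assumes s: "compat s" "compat s'" and l: "linked s s'"
    and pm: "\<And>e. e \<in> E \<Longrightarrow> s e \<in> {-1, 1}" "\<And>e. e \<in> E \<Longrightarrow> s' e \<in> {-1, 1}"
    and e: "e \<in> E"
  shows "s e = s' e"
proof -
  obtain v z where v: "v \<in> flows" "z \<in> tensions" and diff: "\<forall>e\<in>E. s e - s' e = v e + z e"
      and off: "\<forall>e\<in>E - cyc s. v e = 0" "\<forall>e\<in>E - cocyc s. z e = 0"
    using l unfolding linked_def by blast
  have part: "cyc s = E - cocyc s" using cyc_eq compat_nonzero[OF s(1)] by blast
  have vz: "v e = 0 \<or> z e = 0" if "e \<in> E" for e using off part that by blast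
  have "v e = 0"
    using vz diff by (intro linked_compat_flow_zero[OF s pm v(1) _ e]) force+
  moreover have "z e = 0"
    using vz diff compat_dual s
    by (intro oriented_pair.linked_compat_flow_zero[OF dual_pair _ _ pm v(2) _ e]) force+
  ultimately show ?thesis using diff e by force
qed

end

section \<open>Reversal classes\<close>

text \<open>Integral orientations on top of \<open>oriented_pair\<close>. The sets \<open>S\<close> and \<open>S'\<close> consist of
  the signed circuits and cocircuits along which reversals are allowed; the negatives of the
  chosen ones are among them, as these reversals lead to the compatible orientation of a class.\<close>
locale reversal_system =
  oriented_pair E Bs Cs Ds "\<lambda>C e. real_of_int (\<sigma> C e)" "\<lambda>D e. real_of_int (\<sigma>' D e)" w w'
  for E :: "'e set" and Bs Cs Ds and \<sigma> \<sigma>' :: "'e set \<Rightarrow> 'e \<Rightarrow> int" and w w' +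
  fixes S S' :: "('e \<Rightarrow> int) set"
  assumes circuit_value: "C \<in> Cs \<Longrightarrow> \<sigma> C e \<in> {-1, 0, 1}"
    and cocircuit_value: "D \<in> Ds \<Longrightarrow> \<sigma>' D e \<in> {-1, 0, 1}"
    and signed_sub: "x \<in> S \<Longrightarrow> signed_support x \<subseteq> E"
    and cosigned_sub: "x \<in> S' \<Longrightarrow> signed_support x \<subseteq> E"
    and signed_flow: "x \<in> S \<Longrightarrow> (\<lambda>e. real_of_int (x e)) \<in> flows"
    and cosigned_tension: "x \<in> S' \<Longrightarrow> (\<lambda>e. real_of_int (x e)) \<in> tensions"
    and neg_signed: "C \<in> Cs \<Longrightarrow> (\<lambda>e. - \<sigma> C e) \<in> S"
    and neg_cosigned: "D \<in> Ds \<Longrightarrow> (\<lambda>e. - \<sigma>' D e) \<in> S'"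
begin

abbreviation re :: "('e \<Rightarrow> int) \<Rightarrow> 'e \<Rightarrow> real" where "re \<O> \<equiv> \<lambda>e. real_of_int (\<O> e)"

definition step :: "(('e \<Rightarrow> int) \<times> ('e \<Rightarrow> int)) set" where
  "step = {(\<O>, reversal x \<O>) | \<O> x. \<O> \<in> orientations E \<and> x \<in> S \<union> S' \<and> compatible \<O> x}"

definition reversal_eq :: "(('e \<Rightarrow> int) \<times> ('e \<Rightarrow> int)) set" where
  "reversal_eq = (step \<union> step\<inverse>)\<^sup>* \<inter> orientations E \<times> orientations E"

lemma orientation_value: "\<O> \<in> orientations E \<Longrightarrow> e \<in> E \<Longrightarrow> re \<O> e \<in> {-1, 1}"
  by (auto simp: orientations_def PiE_iff)

lemma orientation_nonzero: "\<O> \<in> orientations E \<Longrightarrow> e \<in> E \<Longrightarrow> re \<O> e \<noteq> 0"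
  using orientation_value[of \<O> e] by auto

lemma reversal_orientation:
  assumes "\<O> \<in> orientations E" "signed_support x \<subseteq> E"
  shows "reversal x \<O> \<in> orientations E"
  using assms by (auto simp: orientations_def reversal_def PiE_iff extensional_def)

lemma reversal_diff: "compatible \<O> x \<Longrightarrow> reversal x \<O> e = \<O> e - 2 * x e"
  by (auto simp: reversal_def compatible_def signed_support_def)

lemma compatible_conformal:
  assumes \<O>: "\<O> \<in> orientations E" and x: "compatible \<O> x"
  shows "conformal E (re \<O>) (\<lambda>e. 2 * re x e)" "conformal E (re (reversal x \<O>)) (\<lambda>e. - (2 * re x e))"
proof -
  have "0 \<le> \<O> e * x e \<and> reversal x \<O> e * x e \<le> 0" for e
  proof (cases "x e = 0")
    case False
    then have "\<O> e = x e" using x by (simp add: compatible_def signed_support_def)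
    moreover have "reversal x \<O> e = - x e" using reversal_diff[OF x, of e] calculation by simp
    ultimately show ?thesis by simp
  qed simp
  then have "0 \<le> re \<O> e * re x e" "re (reversal x \<O>) e * re x e \<le> 0" for e
    by (metis of_int_0_le_iff of_int_mult, metis of_int_le_0_iff of_int_mult)
  moreover have "a * (2 * b) = 2 * (a * b)" for a b :: real by simp
  ultimately show "conformal E (re \<O>) (\<lambda>e. 2 * re x e)"
    "conformal E (re (reversal x \<O>)) (\<lambda>e. - (2 * re x e))"
    by (simp_all only: conformal_def mult_minus_right neg_0_le_iff_le) (simp_all add: mult_le_0_iff)
qed

lemma step_linked:
  assumes "(\<O>, \<O>') \<in> step"
  shows "\<O> \<in> orientations E \<and> \<O>' \<in> orientations E \<and> linked (re \<O>) (re \<O>')"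
proof -
  obtain x where \<O>: "\<O> \<in> orientations E" and x: "x \<in> S \<union> S'" "compatible \<O> x" and \<O>': "\<O>' = reversal x \<O>"
    using assms by (auto simp: step_def)
  have \<O>'E: "\<O>' \<in> orientations E"
    unfolding \<O>' using x signed_sub cosigned_sub by (intro reversal_orientation[OF \<O>]) auto
  note nz = orientation_nonzero[OF \<O>] orientation_nonzero[OF \<O>'E]
  note conf = compatible_conformal[OF \<O> x(2), folded \<O>']
  have diff: "re \<O> e - re \<O>' e = 2 * re x e" for e
    unfolding \<O>' reversal_diff[OF x(2)] by simp
  have "linked (re \<O>) (re \<O>')"
  proof (cases "x \<in> S")
    case True
    show ?thesis
      by (rule linked_flow_reversal[OF nz ann_linear(3)[OF signed_flow[OF True]] diff conf])
  next
    case False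
    then have "x \<in> S'" using x(1) by simp
    then show ?thesis
      using oriented_pair.linked_flow_reversal[OF dual_pair nz
          ann_linear(3)[OF cosigned_tension] diff conf]
      by (intro linked_if_dual_linked)
  qed
  then show ?thesis using \<O> \<O>'E by blast
qed

lemma reversal_eq_linked:
  assumes "(\<O>, \<O>') \<in> reversal_eq"
  shows "linked (re \<O>) (re \<O>')"
proof -
  have "(\<O>, \<O>') \<in> (step \<union> step\<inverse>)\<^sup>*" using assms by (simp add: reversal_eq_def)
  then show ?thesis
  proof (induction rule: rtrancl_induct)
    case base
    show ?case by (rule linked_refl)
  next
    case (step P Q)
    then have "linked (re P) (re Q)" using step_linked linked_sym by blast
    then show ?case using linked_trans step.IH by blast
  qed
qed

lemma equiv_reversal_eq: "equiv (orientations E) reversal_eq"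
proof -
  have "sym ((step \<union> step\<inverse>)\<^sup>*)" by (intro sym_rtrancl) (auto simp: sym_def)
  moreover have "trans ((step \<union> step\<inverse>)\<^sup>*)" by (rule trans_rtrancl)
  ultimately show ?thesis
    unfolding reversal_eq_def
    by (intro equivI refl_onI symI transI) (blast dest: symD transD)+
qed

lemma step_in_reversal_eq:
  assumes "(P, \<O>) \<in> reversal_eq" "x \<in> S \<union> S'" "compatible \<O> x"
  shows "(P, reversal x \<O>) \<in> reversal_eq"
proof -
  have "\<O> \<in> orientations E" using assms(1) by (simp add: reversal_eq_def)
  then have st: "(\<O>, reversal x \<O>) \<in> step" using assms by (auto simp: step_def)
  then have "reversal x \<O> \<in> orientations E" using step_linked by blast
  moreover have "(P, reversal x \<O>) \<in> (step \<union> step\<inverse>)\<^sup>*"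
    using assms(1) st unfolding reversal_eq_def by (auto intro: rtrancl.rtrancl_into_rtrancl)
  ultimately show ?thesis using assms(1) by (simp add: reversal_eq_def)
qed

lemma finite_orientations: "finite (orientations E)"
  unfolding orientations_def using finite_E by (intro finite_PiE) auto

lemma opposite_compatible:
  assumes \<O>: "\<O> \<in> orientations E" and x: "\<And>e. x e \<in> {-1, 0, 1}" "signed_support x \<subseteq> E"
    and neg: "\<And>e. e \<in> signed_support x \<Longrightarrow> \<not> 0 < re \<O> e * re x e"
  shows "compatible \<O> (\<lambda>e. - x e)"
  unfolding compatible_def
proof
  fix e assume "e \<in> signed_support (\<lambda>e. - x e)"
  then have e: "e \<in> signed_support x" by (simp add: signed_support_def)
  then have "\<O> e \<in> {-1, 1}" "x e \<in> {-1, 1}"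
    using \<O> x(1)[of e] x(2) by (auto simp: orientations_def PiE_iff signed_support_def)
  then show "\<O> e = - x e" using neg[OF e] by auto
qed

lemma circuit_support: "C \<in> Cs \<Longrightarrow> signed_support (\<sigma> C) = C"
  using circuit_supp by (auto simp: signed_support_def)

lemma cocircuit_support: "D \<in> Ds \<Longrightarrow> signed_support (\<sigma>' D) = D"
  using cocircuit_supp by (auto simp: signed_support_def)

text \<open>Reversing \<open>-c C\<close> into \<open>c C\<close> increases the potential \<open>\<langle>w, \<cdot>\<rangle>\<close>, but reversing a cocircuit may
  decrease it. Since the cyclic part is the same in the whole class, one can use \<open>w\<close> on
  the cyclic and \<open>w'\<close> on the acyclic part; then every forbidden circuit or cocircuit allows an
  increase, and a maximum is compatible.\<close>
lemma ex_compat_in_class: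
  assumes P: "P \<in> orientations E"
  shows "\<exists>\<O>. (P, \<O>) \<in> reversal_eq \<and> compat (re \<O>)"
proof -
  define g where "g e = (if e \<in> cyc (re P) then w e else w' e)" for e
  let ?K = "reversal_eq `` {P}"
  let ?F = "\<lambda>\<O>. dot E g (re \<O>)"
  have "?K \<subseteq> orientations E" by (auto simp: reversal_eq_def)
  then have fin: "finite (?F ` ?K)" using finite_orientations finite_subset by blast
  have "P \<in> ?K" using P by (simp add: reversal_eq_def)
  then have "Max (?F ` ?K) \<in> ?F ` ?K" using fin by (intro Max_in) auto
  then obtain \<O> where \<O>: "(P, \<O>) \<in> reversal_eq" and maxO: "?F \<O> = Max (?F ` ?K)" by auto
  have OE: "\<O> \<in> orientations E" using \<O> by (simp add: reversal_eq_def)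
  have nz: "re \<O> e \<noteq> 0" if "e \<in> E" for e using orientation_nonzero[OF OE that] .
  have parts: "cyc (re P) = cyc (re \<O>)" using reversal_eq_linked[OF \<O>] by (simp add: linked_def)
  have max: "0 \<le> dot E g (re x)" if x: "x \<in> S \<union> S'" "compatible \<O> x" for x
  proof -
    have "reversal x \<O> \<in> ?K" using step_in_reversal_eq[OF \<O> x] by simp
    then have "?F (reversal x \<O>) \<le> ?F \<O>" unfolding maxO using fin by (intro Max_ge) auto
    moreover have "?F (reversal x \<O>) = ?F \<O> - 2 * dot E g (re x)"
      unfolding reversal_diff[OF x(2)] by (simp add: dot_linear)
    ultimately show ?thesis by simp
  qed
  have "\<exists>e\<in>C. 0 < re \<O> e * real_of_int (\<sigma> C e)" if C: "C \<in> Cs" for C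
  proof (rule ccontr)
    assume "\<not> ?thesis"
    then have comp: "compatible \<O> (\<lambda>e. - \<sigma> C e)"
      using circuit_support[OF C] circuit_sub[OF C] circuit_value[OF C]
      by (intro opposite_compatible[OF OE]) auto
    have "e \<in> cyc (re \<O>)" if "e \<in> C" for e
    proof -
      have "(\<lambda>e. 2 * re (\<lambda>e. - \<sigma> C e) e) \<in> flows" using signed_flow[OF neg_signed[OF C]] by (rule ann_linear)
      moreover have "2 * re (\<lambda>e. - \<sigma> C e) e \<noteq> 0" using circuit_supp[OF C, of e] that by simp
      moreover have "e \<in> E" using circuit_sub[OF C] that by auto
      ultimately show ?thesis
        using compatible_conformal(1)[OF OE comp] unfolding conformal_part_def by blast
    qed
    then have "g e * re (\<lambda>e. - \<sigma> C e) e = - (w e * re (\<sigma> C) e)" for e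
      using circuit_supp[OF C, of e] by (cases "e \<in> C") (auto simp: g_def parts)
    then have "dot E g (re (\<lambda>e. - \<sigma> C e)) = - dot E w (\<lambda>e. \<sigma> C e)"
      by (simp only: dot_def sum_negf)
    moreover have "0 \<le> dot E g (re (\<lambda>e. - \<sigma> C e))" using max[OF _ comp] neg_signed[OF C] by blast
    ultimately show False using circuit_weight[OF C] by simp
  qed
  moreover have "\<exists>e\<in>D. 0 < re \<O> e * real_of_int (\<sigma>' D e)" if D: "D \<in> Ds" for D
  proof (rule ccontr)
    assume "\<not> ?thesis"
    then have comp: "compatible \<O> (\<lambda>e. - \<sigma>' D e)"
      using cocircuit_support[OF D] cocircuit_sub[OF D] cocircuit_value[OF D]
      by (intro opposite_compatible[OF OE]) auto
    have "e \<notin> cyc (re \<O>)" if "e \<in> D" for e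
    proof -
      have "(\<lambda>e. 2 * re (\<lambda>e. - \<sigma>' D e) e) \<in> tensions"
        using cosigned_tension[OF neg_cosigned[OF D]] by (rule ann_linear)
      moreover have "2 * re (\<lambda>e. - \<sigma>' D e) e \<noteq> 0" using cocircuit_supp[OF D, of e] that by simp
      moreover have "e \<in> E" using cocircuit_sub[OF D] that by auto
      ultimately have "e \<in> cocyc (re \<O>)"
        using compatible_conformal(1)[OF OE comp] unfolding conformal_part_def by blast
      then show ?thesis using cyc_eq[of "re \<O>"] nz by blast
    qed
    then have "g e * re (\<lambda>e. - \<sigma>' D e) e = - (w' e * re (\<sigma>' D) e)" for e
      using cocircuit_supp[OF D, of e] by (cases "e \<in> D") (auto simp: g_def parts)
    then have "dot E g (re (\<lambda>e. - \<sigma>' D e)) = - dot E w' (\<lambda>e. \<sigma>' D e)"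
      by (simp only: dot_def sum_negf)
    moreover have "0 \<le> dot E g (re (\<lambda>e. - \<sigma>' D e))" using max[OF _ comp] neg_cosigned[OF D] by blast
    ultimately show False using cocircuit_weight[OF D] by simp
  qed
  ultimately have "compat (re \<O>)" using nz unfolding compat_def by blast
  then show ?thesis using \<O> by blast
qed

text \<open>The orientation of a basis in the theorem, for arbitrary families of circuits and
  cocircuits.\<close>
definition orient :: "'e set \<Rightarrow> 'e \<Rightarrow> int" where
  "orient B = (\<lambda>e\<in>E. if e \<in> B then \<sigma>' (THE D. D \<in> Ds \<and> D \<subseteq> insert e (E - B)) e
    else \<sigma> (THE C. C \<in> Cs \<and> C \<subseteq> insert e B) e)"

lemma orient_off_basis:
  assumes "B \<in> Bs" "e \<in> E - B" "C \<in> Cs" "C \<subseteq> insert e B"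
  shows "orient B e = \<sigma> C e" "\<sigma> C e \<in> {-1, 1}"
proof -
  show "orient B e = \<sigma> C e"
    using the_fund_circuit[OF assms(1,3,4)] assms(2) by (simp add: orient_def)
  have "e \<in> C" using fund_circuit_mem assms by blast
  then show "\<sigma> C e \<in> {-1, 1}"
    using circuit_value[OF assms(3), of e] circuit_supp[OF assms(3), of e] by auto
qed

lemma orient_on_basis:
  assumes B: "B \<in> Bs" and e: "e \<in> B" and D: "D \<in> Ds" "D \<subseteq> insert e (E - B)"
  shows "orient B e = \<sigma>' D e" "\<sigma>' D e \<in> {-1, 1}"
proof -
  have B': "E - B \<in> (-) E ` Bs" "e \<in> E" using B e basis_sub by auto
  show "orient B e = \<sigma>' D e"
    using oriented_pair.the_fund_circuit[OF dual_pair B'(1) D] e B'(2) by (simp add: orient_def)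
  have "e \<in> D" by (rule oriented_pair.fund_circuit_mem[OF dual_pair B'(1) D])
  then show "\<sigma>' D e \<in> {-1, 1}"
    using cocircuit_value[OF D(1), of e] cocircuit_supp[OF D(1), of e] by auto
qed

lemma orient_orientation: "B \<in> Bs \<Longrightarrow> orient B \<in> orientations E"
proof -
  assume B: "B \<in> Bs"
  have "orient B e \<in> {-1, 1}" if e: "e \<in> E" for e
  proof (cases "e \<in> B")
    case True
    then obtain D where "D \<in> Ds" "D \<subseteq> insert e (E - B)" using ex_fund_cocircuit[OF B] by blast
    then show ?thesis using orient_on_basis[OF B True] by simp
  next
    case False
    then obtain C where "C \<in> Cs" "C \<subseteq> insert e B" using ex_fund_circuit[OF B, of e] e by blast
    then show ?thesis using orient_off_basis[OF B, of e] e False by simp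
  qed
  then show ?thesis by (auto simp: orientations_def orient_def PiE_iff)
qed

lemma induces_orient:
  assumes B: "B \<in> Bs"
  shows "induces B (re (orient B))"
proof -
  have sq: "0 < real_of_int a * real_of_int b" if "a = b" "b \<in> {-1, 1}" for a b
    using that by auto
  show ?thesis
    unfolding induces_def using orient_off_basis[OF B] orient_on_basis[OF B] sq by simp
qed

lemma induces_imp_orient:
  assumes B: "B \<in> Bs" and \<O>: "\<O> \<in> orientations E" and ind: "induces B (re \<O>)"
  shows "\<O> = orient B"
proof
  fix e
  have eq: "a = b" if "0 < real_of_int a * real_of_int b" "b \<in> {-1, 1}" "a \<in> {-1, 1}" for a b
    using that by auto
  show "\<O> e = orient B e"
  proof (cases "e \<in> E")
    case False
    then show ?thesis using \<O> by (simp add: orient_def orientations_def PiE_iff extensional_def)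
  next
    case True
    then have Oe: "\<O> e \<in> {-1, 1}" using \<O> by (auto simp: orientations_def PiE_iff)
    show ?thesis
    proof (cases "e \<in> B")
      case True
      then obtain D where D: "D \<in> Ds" "D \<subseteq> insert e (E - B)" using ex_fund_cocircuit[OF B] by blast
      then have "0 < re \<O> e * real_of_int (\<sigma>' D e)" using ind True unfolding induces_def by blast
      then show ?thesis using orient_on_basis[OF B True D] eq[OF _ _ Oe] by simp
    next
      case False
      then have eB: "e \<in> E - B" using \<open>e \<in> E\<close> by simp
      then obtain C where C: "C \<in> Cs" "C \<subseteq> insert e B" using ex_fund_circuit[OF B] by blast
      then have "0 < re \<O> e * real_of_int (\<sigma> C e)" using ind eB unfolding induces_def by blast
      then show ?thesis using orient_off_basis[OF B eB C] eq[OF _ _ Oe] by simp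
    qed
  qed
qed

text \<open>Both directions pass through the unique compatible orientation of a class.\<close>
theorem bases_biject_with_reversal_classes:
  "bij_betw (\<lambda>B. reversal_eq `` {orient B}) Bs (orientations E // reversal_eq)"
proof (rule bij_betw_imageI)
  show "inj_on (\<lambda>B. reversal_eq `` {orient B}) Bs"
  proof
    fix B1 B2 assume B: "B1 \<in> Bs" "B2 \<in> Bs"
      and eq: "reversal_eq `` {orient B1} = reversal_eq `` {orient B2}"
    have "(orient B1, orient B2) \<in> reversal_eq"
      using eq_equiv_class[OF eq equiv_reversal_eq] orient_orientation[OF B(2)] by blast
    then have l: "linked (re (orient B1)) (re (orient B2))" by (rule reversal_eq_linked)
    have "re (orient B1) e = re (orient B2) e" if "e \<in> E" for e
      using induces_compat[OF _ induces_orient] B orientation_value[OF orient_orientation] that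
      by (intro linked_compat_eq[OF _ _ l]) auto
    then have "orient B1 e = orient B2 e" for e
      by (cases "e \<in> E") (auto simp: orient_def)
    then have "orient B1 = orient B2" by blast
    then show "B1 = B2" using induces_unique[OF B] induces_orient B by metis
  qed
  show "(\<lambda>B. reversal_eq `` {orient B}) ` Bs = orientations E // reversal_eq"
  proof
    show "(\<lambda>B. reversal_eq `` {orient B}) ` Bs \<subseteq> orientations E // reversal_eq"
      using orient_orientation by (auto intro: quotientI)
    show "orientations E // reversal_eq \<subseteq> (\<lambda>B. reversal_eq `` {orient B}) ` Bs"
    proof
      fix X assume "X \<in> orientations E // reversal_eq"
      then obtain P where P: "P \<in> orientations E" "X = reversal_eq `` {P}" by (rule quotientE)
      obtain \<O> where \<O>: "(P, \<O>) \<in> reversal_eq" "compat (re \<O>)" using ex_compat_in_class[OF P(1)] by blast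
      obtain B where B: "B \<in> Bs" "induces B (re \<O>)" using compat_induced_by_basis[OF \<O>(2)] by blast
      have "\<O> \<in> orientations E" using \<O>(1) by (simp add: reversal_eq_def)
      then have "\<O> = orient B" using B by (intro induces_imp_orient)
      then have "X = reversal_eq `` {orient B}"
        using equiv_class_eq[OF equiv_reversal_eq \<O>(1)] P(2) by simp
      then show "X \<in> (\<lambda>B. reversal_eq `` {orient B}) ` Bs" using B(1) by blast
    qed
  qed
qed

end

section \<open>Bases, circuits and cocircuits of a matroid\<close>
lemma ex_minimal_violator:
  assumes "finite E" "X \<subseteq> E" "\<not> P X"
  shows "\<exists>C\<in>circuits E P. C \<subseteq> X"
proof -
  have "finite X" using assms finite_subset by blast
  then show ?thesis
    using assms(2,3)
  proof (induction X rule: finite_psubset_induct)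
    case (psubset X)
    show ?case
    proof (cases "\<forall>D. D \<subset> X \<longrightarrow> P D")
      case True
      then show ?thesis using psubset.prems by (auto simp: circuits_def)
    next
      case False
      then obtain D where D: "D \<subset> X" "\<not> P D" by blast
      then show ?thesis using psubset.IH[of D] psubset.prems by blast
    qed
  qed
qed

context matroid
begin

lemma indep_finite: "indep X \<Longrightarrow> finite X"
  using finite_ground indep_subset_ground finite_subset by blast

lemma basis_indep: "B \<in> bases indep \<Longrightarrow> indep B"
  by (simp add: bases_def)

lemma basis_subset_ground: "B \<in> bases indep \<Longrightarrow> B \<subseteq> E"
  using basis_indep indep_subset_ground by blast

lemma basis_card_max:
  assumes B: "B \<in> bases indep" and X: "indep X"
  shows "card X \<le> card B"
proof (rule ccontr)
  assume "\<not> ?thesis"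
  then obtain e where "e \<in> X - B" "indep (insert e B)"
    using indep_augment[OF basis_indep[OF B] X] by auto
  then show False using B unfolding bases_def by blast
qed

lemma max_card_indep_extension:
  assumes X: "indep X" and Y: "X \<subseteq> Y"
  shows "\<exists>Z. (indep Z \<and> X \<subseteq> Z \<and> Z \<subseteq> Y) \<and>
    (\<forall>Z'. indep Z' \<and> X \<subseteq> Z' \<and> Z' \<subseteq> Y \<longrightarrow> card Z' \<le> card Z)"
proof -
  let ?P = "\<lambda>Z. indep Z \<and> X \<subseteq> Z \<and> Z \<subseteq> Y"
  have "\<forall>Z. ?P Z \<longrightarrow> card Z < Suc (card E)"
    using indep_subset_ground card_mono[OF finite_ground] by (auto simp: less_Suc_eq_le)
  moreover have "?P X" using assms by simp
  ultimately show ?thesis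
    using ex_has_greatest_nat[of ?P X card "Suc (card E)"] by (auto simp: less_imp_le)
qed

lemma ex_basis: "bases indep \<noteq> {}"
proof -
  obtain Z where Z: "indep Z" "\<forall>Z'. indep Z' \<longrightarrow> card Z' \<le> card Z"
    using max_card_indep_extension[OF indep_empty, of UNIV] by auto
  have "X = Z" if "indep X" "Z \<subseteq> X" for X
    using card_seteq[OF indep_finite[OF that(1)] that(2)] Z(2) that(1) by auto
  then show ?thesis using Z(1) unfolding bases_def by blast
qed

lemma extend_to_basis:
  assumes X: "indep X" and B: "B \<in> bases indep"
  shows "\<exists>B'\<in>bases indep. X \<subseteq> B' \<and> B' \<subseteq> X \<union> B"
proof -
  obtain Z where Z: "indep Z" "X \<subseteq> Z" "Z \<subseteq> X \<union> B"
    and max: "\<forall>Z'. indep Z' \<and> X \<subseteq> Z' \<and> Z' \<subseteq> X \<union> B \<longrightarrow> card Z' \<le> card Z"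
    using max_card_indep_extension[OF X, of "X \<union> B"] by auto
  have ge: "card B \<le> card Z"
  proof (rule ccontr)
    assume "\<not> ?thesis"
    then obtain e where e: "e \<in> B - Z" "indep (insert e Z)"
      using indep_augment[OF Z(1) basis_indep[OF B]] by auto
    then have "card (insert e Z) \<le> card Z" using Z max by auto
    then show False using e indep_finite[OF Z(1)] by simp
  qed
  have "W = Z" if W: "indep W" "Z \<subseteq> W" for W
    using card_seteq[OF indep_finite[OF W(1)] W(2)] basis_card_max[OF B W(1)] ge by auto
  then have "Z \<in> bases indep" using Z(1) unfolding bases_def by blast
  then show ?thesis using Z by blast
qed

lemma basis_antichain:
  assumes "B1 \<in> bases indep" "B2 \<in> bases indep" "B1 \<subseteq> B2"
  shows "B1 = B2"
  using assms unfolding bases_def by blast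

lemma basis_between:
  assumes B: "B1 \<in> bases indep" "B2 \<in> bases indep"
    and XY: "X \<subseteq> B1" "Y \<subseteq> E - B2" "X \<inter> Y = {}"
  shows "\<exists>B\<in>bases indep. X \<subseteq> B \<and> Y \<subseteq> E - B"
proof -
  have "indep X" using indep_subset basis_indep B(1) XY(1) by blast
  then obtain B where "B \<in> bases indep" "X \<subseteq> B" "B \<subseteq> X \<union> B2"
    using extend_to_basis[OF _ B(2)] by blast
  then show ?thesis using XY by blast
qed

lemma basis_or_circuit:
  assumes "X \<subseteq> E"
  shows "(\<exists>B\<in>bases indep. X \<subseteq> B) \<or> (\<exists>C\<in>circuits E indep. C \<subseteq> X)"
proof (cases "indep X")
  case True
  then show ?thesis using ex_basis extend_to_basis[OF True] by blast
next
  case False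
  then show ?thesis using ex_minimal_violator[OF finite_ground assms] by blast
qed

lemma cobasis_or_cocircuit:
  assumes "Y \<subseteq> E"
  shows "(\<exists>B\<in>bases indep. Y \<subseteq> E - B) \<or> (\<exists>D\<in>cocircuits E indep. D \<subseteq> Y)"
  using ex_minimal_violator[OF finite_ground assms, of "dual_indep E indep"]
  by (auto simp: dual_indep_def cocircuits_def)

lemma ex_fund_circuit:
  assumes B: "B \<in> bases indep" and e: "e \<in> E - B"
  shows "\<exists>C\<in>circuits E indep. e \<in> C \<and> C \<subseteq> insert e B"
proof -
  have "\<not> indep (insert e B)" using B e unfolding bases_def by blast
  moreover have "insert e B \<subseteq> E" using e basis_subset_ground[OF B] by blast
  ultimately obtain C where C: "C \<in> circuits E indep" "C \<subseteq> insert e B"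
    using ex_minimal_violator[OF finite_ground, of "insert e B" indep] by blast
  have "e \<in> C"
  proof (rule ccontr)
    assume "e \<notin> C"
    then have "indep C" using C(2) indep_subset[OF basis_indep[OF B]] by blast
    then show False using C(1) by (simp add: circuits_def)
  qed
  then show ?thesis using C by blast
qed

text \<open>A basis disjoint from \<open>insert e (E - B)\<close> would be properly contained in \<open>B\<close>.\<close>
lemma ex_fund_cocircuit:
  assumes B: "B \<in> bases indep" and e: "e \<in> B"
  shows "\<exists>D\<in>cocircuits E indep. e \<in> D \<and> D \<subseteq> insert e (E - B)"
proof -
  have "\<not> insert e (E - B) \<subseteq> E - B'" if B': "B' \<in> bases indep" for B'
  proof
    assume sub: "insert e (E - B) \<subseteq> E - B'"
    then have "B' \<subseteq> B" using basis_subset_ground[OF B'] by blast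
    then have "B' = B" using basis_antichain B B' by blast
    then show False using sub e by blast
  qed
  moreover have "insert e (E - B) \<subseteq> E" using e basis_subset_ground[OF B] by blast
  ultimately obtain D where D: "D \<in> cocircuits E indep" "D \<subseteq> insert e (E - B)"
    using cobasis_or_cocircuit[of "insert e (E - B)"] by blast
  have "e \<in> D"
  proof (rule ccontr)
    assume "e \<notin> D"
    then have "dual_indep E indep D" using D(2) B by (auto simp: dual_indep_def)
    then show False using D(1) by (simp add: cocircuits_def circuits_def)
  qed
  then show ?thesis using D by blast
qed

end

section \<open>Signed circuits and cocircuits of a matrix\<close>
lemma kernel_row_space_orthogonal:
  fixes A :: "real mat"
  assumes A: "A \<in> carrier_mat r n" and x: "x \<in> mat_kernel A" and y: "y \<in> vec_space.row_space n A"
  shows "x \<bullet> y = 0"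
proof -
  obtain z where z: "z \<in> carrier_vec r" "y = A\<^sup>T *\<^sub>v z"
    using y A unfolding vec_space.row_space_eq[OF A] by auto
  have xc: "x \<in> carrier_vec n" "A *\<^sub>v x = 0\<^sub>v r" using mat_kernelD[OF A x] by auto
  have "y \<bullet> x = z \<bullet> (A *\<^sub>v x)" unfolding z(2) by (rule transpose_vec_mult_scalar[OF A xc(1) z(1)])
  then have "y \<bullet> x = 0" using xc(2) z(1) by simp
  moreover have "y \<in> carrier_vec n" using z A by simp
  ultimately show ?thesis using comm_scalar_prod[OF xc(1)] by simp
qed

lemma scalar_prod_to_vec:
  assumes ix: "bij_betw ix E {0..<card E}"
  shows "to_vec ix E x \<bullet> to_vec ix E y = dot E (\<lambda>e. real_of_int (x e)) (\<lambda>e. real_of_int (y e))"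
proof -
  have "to_vec ix E x \<bullet> to_vec ix E y
      = (\<Sum>j\<in>{0..<card E}. real_of_int (x (inv_into E ix j)) * real_of_int (y (inv_into E ix j)))"
    by (simp add: scalar_prod_def to_vec_def)
  also have "\<dots> = (\<Sum>e\<in>E. real_of_int (x e) * real_of_int (y e))"
    by (rule sum.reindex_bij_betw[OF bij_betw_inv_into[OF ix]])
  finally show ?thesis by (simp add: dot_def)
qed

lemma to_vec_minus: "to_vec ix E (\<lambda>e. - x e) = (- 1) \<cdot>\<^sub>v to_vec ix E x"
  by (rule eq_vecI) (simp_all add: to_vec_def)

lemma neg_sign_vector: "x \<in> sign_vectors E \<Longrightarrow> (\<lambda>e. - x e) \<in> sign_vectors E"
  by (auto simp: sign_vectors_def)

lemma signed_support_minus: "signed_support (\<lambda>e. - x e) = signed_support x"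
  by (simp add: signed_support_def)

lemma neg_signed_circuit:
  assumes A: "A \<in> carrier_mat r n" and x: "x \<in> signed_circuits A ix E indep"
  shows "(\<lambda>e. - x e) \<in> signed_circuits A ix E indep"
proof -
  have k: "to_vec ix E x \<in> mat_kernel A" using x by (simp add: signed_circuits_def)
  have "(- 1) \<cdot>\<^sub>v to_vec ix E x \<in> mat_kernel A"
    using mat_kernelD[OF A k] by (intro mat_kernelI[OF A]) (auto simp: mult_mat_vec[OF A] intro!: eq_vecI)
  then show ?thesis
    using x neg_sign_vector by (auto simp: signed_circuits_def to_vec_minus signed_support_minus fun_eq_iff)
qed

lemma neg_signed_cocircuit:
  assumes A: "A \<in> carrier_mat r (card E)" and x: "x \<in> signed_cocircuits A ix E indep"
  shows "(\<lambda>e. - x e) \<in> signed_cocircuits A ix E indep"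
proof -
  have k: "to_vec ix E x \<in> vec_space.row_space (card E) A" using x by (simp add: signed_cocircuits_def)
  then obtain z where z: "z \<in> carrier_vec r" "to_vec ix E x = A\<^sup>T *\<^sub>v z"
    using A unfolding vec_space.row_space_eq[OF A] by auto
  have "A\<^sup>T *\<^sub>v ((- 1) \<cdot>\<^sub>v z) = (- 1) \<cdot>\<^sub>v to_vec ix E x"
    using A z by (simp add: mult_mat_vec[of "A\<^sup>T" "card E" r])
  moreover have "(- 1) \<cdot>\<^sub>v z \<in> carrier_vec r" using z by simp
  moreover have "(- 1) \<cdot>\<^sub>v to_vec ix E x \<in> carrier_vec (card E)" by (simp add: to_vec_def)
  ultimately have "(- 1) \<cdot>\<^sub>v to_vec ix E x \<in> vec_space.row_space (card E) A"
    using A unfolding vec_space.row_space_eq[OF A] by auto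
  then show ?thesis
    using x neg_sign_vector by (auto simp: signed_cocircuits_def to_vec_minus signed_support_minus fun_eq_iff)
qed

lemma acyclic_signature_weight:
  assumes "finite E" "K \<subseteq> Pow E" "acyclic_signature E K \<sigma>"
  obtains w where "\<And>C. C \<in> K \<Longrightarrow> 0 < dot E w (\<lambda>e. real_of_int (\<sigma> C e))"
proof (rule gordan[of E K "\<lambda>C e. real_of_int (\<sigma> C e)"])
  show "finite E" "finite K" using assms finite_subset by auto
  show "\<forall>C\<in>K. a C = 0"
    if "\<And>C. C \<in> K \<Longrightarrow> 0 \<le> a C" "\<And>e. e \<in> E \<Longrightarrow> (\<Sum>C\<in>K. a C * real_of_int (\<sigma> C e)) = 0" for a
    using assms(3) that unfolding acyclic_signature_def by simp
qed (use that in blast)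

theorem theorem1p2p2:
  fixes E :: "'e set" and indep :: "'e set \<Rightarrow> bool"
    and r :: nat and A :: "real mat" and ix :: "'e \<Rightarrow> nat"
    and \<sigma> \<sigma>' :: "'e set \<Rightarrow> 'e \<Rightarrow> int"
  assumes "matroid E indep"
    and "represents r A ix E indep"
    and "totally_unimodular A"
    and "vec_space.rank r A = r"
    and "signature (circuits E indep) (signed_circuits A ix E indep) \<sigma>"
    and "acyclic_signature E (circuits E indep) \<sigma>"
    and "signature (cocircuits E indep) (signed_cocircuits A ix E indep) \<sigma>'"
    and "acyclic_signature E (cocircuits E indep) \<sigma>'"
  shows "bij_betw (\<lambda>B. reversal_class A ix E indep (basis_orientation E indep \<sigma> \<sigma>' B))
           (bases indep) (reversal_classes A ix E indep)"
proof -
  interpret matroid E indep by (fact assms(1))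
  have A: "A \<in> carrier_mat r (card E)" and ix: "bij_betw ix E {0..<card E}"
    using assms(2) by (simp_all add: represents_def)
  let ?Cs = "circuits E indep" and ?Ds = "cocircuits E indep"
  let ?S = "signed_circuits A ix E indep" and ?S' = "signed_cocircuits A ix E indep"
  have sub: "?Cs \<subseteq> Pow E" "?Ds \<subseteq> Pow E" by (auto simp: circuits_def cocircuits_def)
  obtain w where w: "\<And>C. C \<in> ?Cs \<Longrightarrow> 0 < dot E w (\<lambda>e. real_of_int (\<sigma> C e))"
    using acyclic_signature_weight[OF finite_ground sub(1) assms(6)] by blast
  obtain w' where w': "\<And>D. D \<in> ?Ds \<Longrightarrow> 0 < dot E w' (\<lambda>e. real_of_int (\<sigma>' D e))"
    using acyclic_signature_weight[OF finite_ground sub(2) assms(8)] by blast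
  have \<sigma>: "\<sigma> C \<in> ?S" "signed_support (\<sigma> C) = C" if "C \<in> ?Cs" for C
    using assms(5) that by (simp_all add: signature_def)
  have \<sigma>': "\<sigma>' D \<in> ?S'" "signed_support (\<sigma>' D) = D" if "D \<in> ?Ds" for D
    using assms(7) that by (simp_all add: signature_def)
  have orth: "dot E (\<lambda>e. real_of_int (x e)) (\<lambda>e. real_of_int (y e)) = 0" if "x \<in> ?S" "y \<in> ?S'" for x y
    using kernel_row_space_orthogonal[OF A, of "to_vec ix E x" "to_vec ix E y"] that
    by (simp add: scalar_prod_to_vec[OF ix] signed_circuits_def signed_cocircuits_def)
  have sign_value: "x e \<in> {-1, 0, 1}" if "x \<in> sign_vectors E" for x and e :: 'e
    using that by (cases "e \<in> E") (auto simp: sign_vectors_def)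
  interpret reversal_system E "bases indep" ?Cs ?Ds \<sigma> \<sigma>' w w' ?S ?S'
  proof
    show "finite E" by (fact finite_ground)
    show "B \<subseteq> E" if "B \<in> bases indep" for B using basis_subset_ground that .
    show "B1 = B2" if "B1 \<in> bases indep" "B2 \<in> bases indep" "B1 \<subseteq> B2" for B1 B2
      using basis_antichain that .
    show "\<exists>B\<in>bases indep. X \<subseteq> B \<and> Y \<subseteq> E - B"
      if "B1 \<in> bases indep" "B2 \<in> bases indep" "X \<subseteq> B1" "Y \<subseteq> E - B2" "X \<inter> Y = {}" for B1 B2 X Y
      using basis_between that .
    show "C \<subseteq> E" if "C \<in> ?Cs" for C using sub that by blast
    show "D \<subseteq> E" if "D \<in> ?Ds" for D using sub that by blast
    show "(\<exists>B\<in>bases indep. X \<subseteq> B) \<or> (\<exists>C\<in>?Cs. C \<subseteq> X)" if "X \<subseteq> E" for X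
      using basis_or_circuit that .
    show "(\<exists>B\<in>bases indep. Y \<subseteq> E - B) \<or> (\<exists>D\<in>?Ds. D \<subseteq> Y)" if "Y \<subseteq> E" for Y
      using cobasis_or_cocircuit that .
    show "\<exists>C\<in>?Cs. e \<in> C \<and> C \<subseteq> insert e B" if "B \<in> bases indep" "e \<in> E - B" for B e
      using ex_fund_circuit that .
    show "\<exists>D\<in>?Ds. e \<in> D \<and> D \<subseteq> insert e (E - B)" if "B \<in> bases indep" "e \<in> B" for B e
      using ex_fund_cocircuit that .
    show "real_of_int (\<sigma> C e) \<noteq> 0 \<longleftrightarrow> e \<in> C" if "C \<in> ?Cs" for C e
      using \<sigma>(2)[OF that] by (auto simp: signed_support_def)
    show "real_of_int (\<sigma>' D e) \<noteq> 0 \<longleftrightarrow> e \<in> D" if "D \<in> ?Ds" for D e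
      using \<sigma>'(2)[OF that] by (auto simp: signed_support_def)
    show "dot E (\<lambda>e. real_of_int (\<sigma> C e)) (\<lambda>e. real_of_int (\<sigma>' D e)) = 0"
      if "C \<in> ?Cs" "D \<in> ?Ds" for C D
      using orth \<sigma>(1) \<sigma>'(1) that by blast
    show "0 < dot E w (\<lambda>e. real_of_int (\<sigma> C e))" if "C \<in> ?Cs" for C using w that .
    show "0 < dot E w' (\<lambda>e. real_of_int (\<sigma>' D e))" if "D \<in> ?Ds" for D using w' that .
    show "\<sigma> C e \<in> {-1, 0, 1}" if "C \<in> ?Cs" for C e
      using \<sigma>(1)[OF that] by (intro sign_value) (simp add: signed_circuits_def)
    show "\<sigma>' D e \<in> {-1, 0, 1}" if "D \<in> ?Ds" for D e
      using \<sigma>'(1)[OF that] by (intro sign_value) (simp add: signed_cocircuits_def)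
    show "signed_support x \<subseteq> E" if "x \<in> ?S" for x
      using that sub by (auto simp: signed_circuits_def)
    show "signed_support x \<subseteq> E" if "x \<in> ?S'" for x
      using that sub by (auto simp: signed_cocircuits_def)
    show "(\<lambda>e. real_of_int (x e)) \<in> ann E ?Ds (\<lambda>D e. real_of_int (\<sigma>' D e))" if "x \<in> ?S" for x
      using orth[OF that] \<sigma>'(1) by (simp add: ann_def)
    show "(\<lambda>e. real_of_int (x e)) \<in> ann E ?Cs (\<lambda>C e. real_of_int (\<sigma> C e))" if "x \<in> ?S'" for x
      using orth[OF _ that] \<sigma>(1) by (simp add: ann_def dot_commute[of E "\<lambda>e. real_of_int (x e)"])
    show "(\<lambda>e. - \<sigma> C e) \<in> ?S" if "C \<in> ?Cs" for C
      using neg_signed_circuit[OF A \<sigma>(1)[OF that]] .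
    show "(\<lambda>e. - \<sigma>' D e) \<in> ?S'" if "D \<in> ?Ds" for D
      using neg_signed_cocircuit[OF A \<sigma>'(1)[OF that]] .
  qed
  have "step = reversal_step A ix E indep"
    unfolding step_def reversal_step_def by blast
  then have eq: "reversal_eq = reversal_equiv A ix E indep"
    unfolding reversal_eq_def reversal_equiv_def by simp
  have "orient B = basis_orientation E indep \<sigma> \<sigma>' B" for B
    unfolding orient_def basis_orientation_def fund_circuit_def fund_cocircuit_def by simp
  then show ?thesis
    using bases_biject_with_reversal_classes
    unfolding eq reversal_class_def reversal_classes_def by simp
qed

end
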